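(* Let $q\in(0,2]$, $c\ge1$, and let $f,g:\mathbb{R}\to\mathbb{R}$ be continuous nondecreasing functions with $f$ positive. Let $a\in\mathbb{R}$ and let $\varphi$ be a maximal solution of the Cauchy problem $$\varphi''+\frac{c-1}{r}\varphi'=f(\varphi)+g(\varphi)|\varphi'|^q,\qquad \varphi(0)=a,\qquad \varphi'(0)=0 .$$ Then: \begin{itemize} \item[(i)] if $\lim_{t\to+\infty}g(t)>0$, then $\varphi$ is globally defined on $[0,+\infty)$ if and only if $$q\le1\quad\text{and}\quad\int_0^{+\infty}\frac{dt}{(t f(t))^{1/2}+(t g^+(t))^{1/(2-q)}}=+\infty ;$$ \item[(ii)] if $\lim_{t\to+\infty}g(t)\le0$, then $\varphi$ is globally defined on $[0,+\infty)$ if and only if $$\int_0^{+\infty}\frac{dt}{\left(\int_0^t e^{-2\int_s^t\left(\frac{g^-(\tau)}{f(\tau)}\right)^{2/q}f(\tau)\,d\tau}f(s)\,ds\right)^{1/2}}=+\infty ;$$ \item[(iii)] if $\lim_{t\to+\infty}g(t)<0$, then the condition in (ii) is equivalent to $$\int_0^{+\infty}\left[\frac{1}{(t f(t))^{1/2}}+\frac{1}{f(t)^{1/q}}\right]dt=+\infty .$$ \end{itemize}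
   Context: A solution of the Cauchy problem on $[0,R)$, $0<R\le+\infty$, is a function $\varphi\in C^2((0,R))\cap C([0,R))$ satisfying the ODE on $(0,R)$, $\varphi(0)=a$, $\lim_{r\to0^+}\varphi'(r)=0=\varphi'(0)$, and such that $\lim_{r\to0^+}\varphi''(r)$ exists in $\mathbb{R}$ (so the ODE also holds at $r=0$). A maximal solution is one defined on $[0,R)$ that cannot be extended to a solution on a larger interval. $g^+=\max(g,0)$, $g^-=\max(-g,0)$. *)

theory Defs
  imports "HOL-Analysis.Analysis"
begin

definition cauchy_solution ::
  "(real \<Rightarrow> real) \<Rightarrow> (real \<Rightarrow> real) \<Rightarrow> real \<Rightarrow> real \<Rightarrow> real \<Rightarrow>
   (real \<Rightarrow> real) \<Rightarrow> ereal \<Rightarrow> bool" where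
  "cauchy_solution f g c q a \<phi> R \<longleftrightarrow>
     0 < R \<and>
     \<comment> \<open>C^2 on the open interval (0,R)\<close>
     (\<forall>r. 0 < r \<and> ereal r < R \<longrightarrow> \<phi> differentiable (at r)) \<and>
     (\<forall>r. 0 < r \<and> ereal r < R \<longrightarrow> (deriv \<phi>) differentiable (at r)) \<and>
     continuous_on {r. 0 < r \<and> ereal r < R} (deriv (deriv \<phi>)) \<and>
     \<comment> \<open>continuous on [0,R)\<close>
     continuous_on {r. 0 \<le> r \<and> ereal r < R} \<phi> \<and>
     \<comment> \<open>the ODE on (0,R)\<close>
     (\<forall>r. 0 < r \<and> ereal r < R \<longrightarrow>
        deriv (deriv \<phi>) r + (c - 1) / r * deriv \<phi> r
          = f (\<phi> r) + g (\<phi> r) * \<bar>deriv \<phi> r\<bar> powr q) \<and>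
     \<comment> \<open>initial conditions\<close>
     \<phi> 0 = a \<and>
     (\<phi> has_real_derivative 0) (at_right 0) \<and>
     ((deriv \<phi>) \<longlongrightarrow> 0) (at_right 0) \<and>
     (\<exists>L. ((deriv (deriv \<phi>)) \<longlongrightarrow> L) (at_right 0))"

definition maximal_cauchy_solution ::
  "(real \<Rightarrow> real) \<Rightarrow> (real \<Rightarrow> real) \<Rightarrow> real \<Rightarrow> real \<Rightarrow> real \<Rightarrow>
   (real \<Rightarrow> real) \<Rightarrow> ereal \<Rightarrow> bool" where
  "maximal_cauchy_solution f g c q a \<phi> R \<longleftrightarrow>
     cauchy_solution f g c q a \<phi> R \<and>
     \<not> (\<exists>R' \<psi>. R < R' \<and> cauchy_solution f g c q a \<psi> R' \<and>
                 (\<forall>r. 0 \<le> r \<and> ereal r < R \<longrightarrow> \<psi> r = \<phi> r))"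

end

theory Submission
  imports Defs
begin

text \<open>
  Monotonicity of \<open>f\<close> and \<open>g\<close> makes every solution strictly convex and increasing, and \<open>q \<le> 2\<close>
  bounds \<open>\<phi>'\<close> as long as \<open>\<phi>\<close> is bounded; so a maximal solution always takes arbitrarily large
  values. If \<open>\<phi>'\<close> is comparable to some function \<open>P(\<phi>)\<close>, then the length of the existence interval
  is comparable to \<open>\<integral> dt / P(t)\<close>, and it remains to find \<open>P\<close>. Upper bounds come from dropping the
  damping term \<open>(c - 1) \<phi>' / r\<close>. For the lower bounds, either this term is a small fraction of the
  right-hand side and can be absorbed, or it is not, and then convexity, in the form
  \<open>\<phi> - a \<le> r \<phi>'\<close>, bounds \<open>\<phi>'\<close> from below directly. For \<open>g \<le> 0\<close> the energy \<open>\<phi>'\<^sup>2 / 2\<close>, as a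
  function of \<open>t = \<phi>\<close>, is comparable to the solution \<open>Y\<close> of the linear equation
  \<open>Y' = f - 2 (g\<^sup>- / f)\<^bsup>2/q\<^esup> f Y\<close>.
\<close>

section \<open>Differential inequalities and divergent integrals\<close>

text \<open>No uniqueness of solutions is used: every estimate is made along the given solution,
  through quantities whose monotonicity is checked directly. The form of P comes from a balance. For
  g > 0, multiplying the equation by phi' and integrating suggests phi'^2 ~ t (f + g phi'^q), so
  phi' is the larger of (t f)^(1/2) and (t g)^(1/(2-q)). For g \<le> 0 the undamped energy E =
  phi'^2 / 2 satisfies dE/dt = f (1 - (\<kappa> phi'^2)^(q/2)) with \<kappa> = (g^- / f)^(2/q).
  Replacing the exponent q/2 by 1 gives the linear equation of Y, and both right-hand sides change
  sign at the same level \<kappa> phi'^2 = 1. The solution only sees values t > a, whereas the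
  integrals of the theorem start at 0. Hence the integrands must be O(t^(-1/2)) near 0, and Y
  started at a must be comparable with Y started at 0. Some lower bounds obtained from monotonicity
  involve f and g at t/2; a substitution undoes this.\<close>

lemma le_limit_at_right_if_deriv_nonpos:
  fixes u :: "real \<Rightarrow> real"
  assumes lim: "(u \<longlongrightarrow> L) (at_right s)" and sr: "s < r"
    and der: "\<And>x. s < x \<Longrightarrow> x \<le> r \<Longrightarrow> \<exists>y. (u has_real_derivative y) (at x) \<and> y \<le> 0"
  shows "u r \<le> L"
proof (rule tendsto_lowerbound[OF lim])
  show "\<forall>\<^sub>F x in at_right s. u r \<le> u x"
    unfolding eventually_at_right_field
  proof (intro exI[of _ r] conjI sr allI impI)
    fix x assume "s < x" "x < r"
    then show "u r \<le> u x"
      by (intro DERIV_nonpos_imp_nonincreasing[of x r u] der) auto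
  qed
qed simp

text \<open>Squaring removes the kink of the negative part: at 0 the difference quotient of
  \<open>(min y 0)\<^sup>2\<close> lies between -|h| and |h|.\<close>

lemma DERIV_min_0_square:
  fixes u :: "real \<Rightarrow> real"
  assumes "(u has_real_derivative d) (at x)"
  shows "((\<lambda>x. (min (u x) 0)\<^sup>2) has_real_derivative 2 * min (u x) 0 * d) (at x)"
proof -
  have q: "((\<lambda>y::real. (min y 0)\<^sup>2) has_real_derivative 2 * min y 0) (at y)" for y
  proof (cases y "0::real" rule: linorder_cases)
    case less
    have "((\<lambda>y::real. y\<^sup>2) has_real_derivative 2 * y) (at y)"
      by (auto intro!: derivative_eq_intros)
    then have "((\<lambda>y::real. (min y 0)\<^sup>2) has_real_derivative 2 * y) (at y)"
      by (rule has_field_derivative_transform_within_open[of _ _ _ "{..<0}"]) (use less in \<open>auto simp: min_def\<close>)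
    then show ?thesis using less by (simp add: min_def)
  next
    case greater
    have "((\<lambda>y::real. 0) has_real_derivative 0) (at y)"
      by simp
    then have "((\<lambda>y::real. (min y 0)\<^sup>2) has_real_derivative 0) (at y)"
      by (rule has_field_derivative_transform_within_open[of _ _ _ "{0<..}"]) (use greater in \<open>auto simp: min_def\<close>)
    then show ?thesis using greater by (simp add: min_def)
  next
    case equal
    have "((\<lambda>h::real. ((min h 0)\<^sup>2 - (min 0 0)\<^sup>2) / (h - 0)) \<longlongrightarrow> 0) (at 0)"
    proof (rule tendsto_sandwich[of "\<lambda>h. - \<bar>h\<bar>" _ _ "\<lambda>h. \<bar>h\<bar>"])
      show "((\<lambda>h::real. - \<bar>h\<bar>) \<longlongrightarrow> 0) (at 0)" "((\<lambda>h::real. \<bar>h\<bar>) \<longlongrightarrow> 0) (at 0)"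
        by (auto intro!: tendsto_eq_intros)
    qed (auto simp: eventually_at_filter min_def power2_eq_square)
    then show ?thesis using equal by (simp add: has_field_derivative_iff)
  qed
  show ?thesis
    using DERIV_chain2[OF q assms] by simp
qed

text \<open>The square \<open>(min u 0)\<^sup>2\<close> is nonincreasing, since its derivative
  vanishes where \<open>u\<close> is nonnegative and has the right sign elsewhere; its limit at
  \<open>s\<close> is 0. In this form a differential inequality has to be proved only at points
  where the desired estimate fails.\<close>

lemma nonneg_if_deriv_nonneg_where_neg:
  fixes u :: "real \<Rightarrow> real"
  assumes lim: "(u \<longlongrightarrow> L) (at_right s)" "L \<ge> 0" and sr: "s < r"
    and der: "\<And>x. s < x \<Longrightarrow> x \<le> r \<Longrightarrow> \<exists>y. (u has_real_derivative y) (at x) \<and> (u x < 0 \<longrightarrow> y \<ge> 0)"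
  shows "u r \<ge> 0"
proof -
  have "(min (u r) 0)\<^sup>2 \<le> (min L 0)\<^sup>2"
  proof (rule le_limit_at_right_if_deriv_nonpos[of "\<lambda>x. (min (u x) 0)\<^sup>2", OF _ sr])
    show "((\<lambda>x. (min (u x) 0)\<^sup>2) \<longlongrightarrow> (min L 0)\<^sup>2) (at_right s)"
      by (intro tendsto_intros lim)
    fix x assume x: "s < x" "x \<le> r"
    then obtain y where y: "(u has_real_derivative y) (at x)" "u x < 0 \<longrightarrow> y \<ge> 0"
      using der by blast
    have "2 * min (u x) 0 * y \<le> 0"
      using y(2) by (auto simp: min_def mult_le_0_iff)
    then show "\<exists>y. ((\<lambda>x. (min (u x) 0)\<^sup>2) has_real_derivative y) (at x) \<and> y \<le> 0"
      using DERIV_min_0_square[OF y(1)] by blast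
  qed
  with lim(2) show ?thesis by (auto simp: min_def split: if_splits)
qed

section \<open>Antiderivatives and integrals of nonnegative functions over half-lines\<close>

lemma continuous_antiderivative:
  fixes h :: "real \<Rightarrow> real" and \<tau> :: ereal
  assumes "\<tau> < \<infinity>" "\<And>x. \<tau> < ereal x \<Longrightarrow> isCont h x"
  obtains I where "\<And>x. \<tau> < ereal x \<Longrightarrow> (I has_real_derivative h x) (at x)"
proof -
  have "\<exists>F. \<forall>x. \<tau> < ereal x \<longrightarrow> ereal x < \<infinity> \<longrightarrow> (F has_vector_derivative h x) (at x)"
    by (rule einterval_antiderivative) (use assms in auto)
  then show ?thesis
    using that by (auto simp: has_real_derivative_iff_has_vector_derivative)
qed

lemma nn_integral_atLeast_finite:
  fixes h I :: "real \<Rightarrow> real"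
  assumes "h \<in> borel_measurable borel" and nn: "\<And>x. t0 \<le> x \<Longrightarrow> 0 \<le> h x"
    and I: "\<And>x. t0 \<le> x \<Longrightarrow> (I has_real_derivative h x) (at x)"
    and bnd: "\<And>x. t0 \<le> x \<Longrightarrow> I x \<le> M"
  shows "(\<integral>\<^sup>+t\<in>{t0..}. ennreal (h t) \<partial>lborel) < \<infinity>"
proof -
  define T where "T = (SUP x\<in>{t0..}. I x)"
  have bdd: "bdd_above (I ` {t0..})" using bnd by (auto simp: bdd_above_def)
  have mono: "I x \<le> I y" if "t0 \<le> x" "x \<le> y" for x y
    using that I nn by (intro deriv_nonneg_imp_mono[of x y I h]) auto
  have "(I \<longlongrightarrow> T) at_top"
  proof (rule increasing_tendsto)
    show "\<forall>\<^sub>F n in at_top. I n \<le> T"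
      using eventually_ge_at_top[of t0] by eventually_elim (auto simp: T_def intro!: cSUP_upper bdd)
    fix x assume "x < T"
    then obtain y where y: "y \<ge> t0" "x < I y"
      unfolding T_def by (subst (asm) less_cSUP_iff) (auto intro: bdd)
    show "\<forall>\<^sub>F n in at_top. x < I n"
      using eventually_ge_at_top[of y] by eventually_elim (use y mono in force)
  qed
  then have "(\<integral>\<^sup>+t\<in>{t0..}. ennreal (h t) \<partial>lborel) = ennreal (T - I t0)"
    by (intro nn_integral_FTC_atLeast assms)
  then show ?thesis by simp
qed

lemma nn_integral_atLeast_infinite:
  fixes h I :: "real \<Rightarrow> real"
  assumes h: "h \<in> borel_measurable borel" and nn: "\<And>x. t0 \<le> x \<Longrightarrow> 0 \<le> h x"
    and I: "\<And>x. t0 \<le> x \<Longrightarrow> (I has_real_derivative h x) (at x)"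
    and unb: "\<And>M. \<exists>x\<ge>t0. M \<le> I x"
  shows "(\<integral>\<^sup>+t\<in>{t0..}. ennreal (h t) \<partial>lborel) = \<infinity>"
proof -
  have "ennreal M \<le> (\<integral>\<^sup>+t\<in>{t0..}. ennreal (h t) \<partial>lborel)" for M
  proof -
    obtain x where x: "x \<ge> t0" "M + I t0 \<le> I x" using unb by blast
    have "ennreal M \<le> ennreal (I x - I t0)" using x by (intro ennreal_leI) auto
    also have "\<dots> = (\<integral>\<^sup>+t. ennreal (h t) * indicator {t0..x} t \<partial>lborel)"
      by (subst nn_integral_FTC_Icc[OF h, of t0 x I])
        (use x I nn in \<open>auto simp: has_real_derivative_iff_has_vector_derivative intro: has_vector_derivative_at_within\<close>)
    also have "\<dots> \<le> (\<integral>\<^sup>+t\<in>{t0..}. ennreal (h t) \<partial>lborel)"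
      by (intro nn_integral_mono) (auto simp: indicator_def)
    finally show ?thesis .
  qed
  note * = this
  show ?thesis
  proof (cases "\<integral>\<^sup>+t\<in>{t0..}. ennreal (h t) \<partial>lborel")
    case (real r)
    then show ?thesis using *[of "r + 1"] by (simp add: ennreal_le_iff)
  qed simp
qed

lemma nn_integral_near_0_finite:
  fixes h :: "real \<Rightarrow> real"
  assumes h: "\<And>t. 0 < t \<Longrightarrow> t \<le> T \<Longrightarrow> h t \<le> K / sqrt t" and K: "K \<ge> 0"
  shows "(\<integral>\<^sup>+t\<in>{0..T}. ennreal (h t) \<partial>lborel) < \<infinity>"
proof (cases "T > 0")
  case True
  have "((\<lambda>t. t powr (-1/2)) has_integral (T powr (-1/2 + 1) / (-1/2+1))) {0..T}"
    by (rule has_integral_powr_from_0) (use True in auto)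
  then have "((\<lambda>t. t powr (-1/2) * indicator {0..T} t) has_integral (T powr (-1/2 + 1) / (-1/2+1))) UNIV"
    by (subst (asm) has_integral_restrict_UNIV[symmetric])
      (auto elim!: has_integral_eq[rotated] simp: indicator_def)
  then have *: "(\<integral>\<^sup>+t. ennreal (t powr (-1/2) * indicator {0..T} t) \<partial>lborel) = ennreal (T powr (-1/2 + 1) / (-1/2+1))"
    by (intro nn_integral_has_integral_lborel)
       (auto simp: indicator_def)
  have "(\<integral>\<^sup>+t\<in>{0..T}. ennreal (h t) \<partial>lborel) \<le> (\<integral>\<^sup>+t. ennreal K * ennreal (t powr (-1/2) * indicator {0..T} t) \<partial>lborel)"
  proof (rule nn_integral_mono_AE)
    \<comment> \<open>The hypothesis says nothing about \<open>t = 0\<close>, hence a comparison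
      almost everywhere.\<close>
    have "AE t in lborel. t \<noteq> (0::real)" by (rule AE_lborel_singleton)
    then show "AE t in lborel. ennreal (h t) * indicator {0..T} t \<le> ennreal K * ennreal (t powr (-1/2) * indicator {0..T} t)"
    proof eventually_elim
      case (elim t)
      show ?case
      proof (cases "t \<in> {0..T}")
        case True
        then have "h t \<le> K * t powr (-1/2)"
          using h[of t] elim by (auto simp: powr_minus powr_half_sqrt[symmetric] field_simps)
        then show ?thesis using True K by (simp add: ennreal_mult[symmetric] ennreal_leI)
      qed auto
    qed
  qed
  also have "\<dots> < \<infinity>"
    by (subst nn_integral_cmult, simp) (use * in \<open>simp add: ennreal_mult_less_top del: powr_half_sqrt\<close>)
  finally show ?thesis .
next
  case False
  have "(\<integral>\<^sup>+t\<in>{0..T}. ennreal (h t) \<partial>lborel) = (\<integral>\<^sup>+t. 0 \<partial>(lborel::real measure))"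
  proof (rule nn_integral_cong_AE)
    have "AE t in lborel. t \<noteq> (0::real)" by (rule AE_lborel_singleton)
    then show "AE t in lborel. ennreal (h t) * indicator {0..T} t = 0"
      by eventually_elim (use False in \<open>auto simp: indicator_def\<close>)
  qed
  then show ?thesis by simp
qed

text \<open>Since \<open>1 / sqrt t\<close> is integrable at 0, a divergence over
  \<open>{0..}\<close> must come from infinity, the only region that a solution reaching arbitrarily
  large values can be related to.\<close>

lemma nn_integral_tail_infinite:
  fixes h :: "real \<Rightarrow> real"
  assumes h: "\<And>t. 0 < t \<Longrightarrow> t \<le> T \<Longrightarrow> h t \<le> K / sqrt t" and K: "K \<ge> 0"
    and [measurable]: "h \<in> borel_measurable borel"
    and inf: "(\<integral>\<^sup>+t\<in>{0..}. ennreal (h t) \<partial>lborel) = \<infinity>"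
  shows "(\<integral>\<^sup>+t\<in>{T..}. ennreal (h t) \<partial>lborel) = \<infinity>"
proof -
  have "(\<integral>\<^sup>+t\<in>{0..}. ennreal (h t) \<partial>lborel) \<le>
     (\<integral>\<^sup>+t. ennreal (h t) * indicator {0..T} t + ennreal (h t) * indicator {T..} t \<partial>lborel)"
    by (intro nn_integral_mono) (auto simp: indicator_def)
  also have "\<dots> = (\<integral>\<^sup>+t\<in>{0..T}. ennreal (h t) \<partial>lborel) + (\<integral>\<^sup>+t\<in>{T..}. ennreal (h t) \<partial>lborel)"
    by (subst nn_integral_add) auto
  finally show ?thesis using inf nn_integral_near_0_finite[OF h K]
    by (metis ennreal_add_eq_top infinity_ennreal_def less_irrefl top.extremum_uniqueI)
qed

text \<open>Lower bounds for the derivative of a solution are obtained with \<open>t / 2\<close> in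
  place of \<open>t\<close>; by this substitution the change does not affect divergence.\<close>

lemma nn_integral_halve_argument:
  fixes h :: "real \<Rightarrow> real"
  assumes [measurable]: "h \<in> borel_measurable borel"
  shows "(\<integral>\<^sup>+t\<in>{0..}. ennreal (h (t / 2)) \<partial>lborel) = 2 * (\<integral>\<^sup>+t\<in>{0..}. ennreal (h t) \<partial>lborel)"
proof -
  have "(\<integral>\<^sup>+t\<in>{0..}. ennreal (h (t / 2)) \<partial>lborel)
    = ennreal \<bar>2\<bar> * (\<integral>\<^sup>+t. ennreal (h ((0 + 2 * t) / 2)) * indicator {0..} (0 + 2 * t) \<partial>lborel)"
    by (rule nn_integral_real_affine) auto
  also have "(\<lambda>t::real. ennreal (h ((0 + 2 * t) / 2)) * indicator {0..} (0 + 2 * t)) = (\<lambda>t. ennreal (h t) * indicator {0..} t)"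
    by (auto simp: indicator_def fun_eq_iff)
  finally show ?thesis by simp
qed

text \<open>With \<open>I\<close> an antiderivative of \<open>h\<close>, the derivative of
  \<open>I \<circ> \<phi>\<close> is at most \<open>C\<close>, so \<open>I\<close> stays below
  \<open>I (\<phi> r0) + C * (R - r0)\<close> along the unbounded function \<open>\<phi>\<close>.
  The level \<open>\<tau>\<close> leaves room for integrands that are continuous only on a
  half-line.\<close>

lemma finite_escape_integral_finite:
  fixes \<phi> D h :: "real \<Rightarrow> real"
  assumes h: "h \<in> borel_measurable borel" "\<And>t. \<tau> < t \<Longrightarrow> isCont h t" "\<And>t. \<tau> < t \<Longrightarrow> 0 \<le> h t"
    and r0: "r0 < R" "\<tau> < \<phi> r0"
    and \<phi>: "\<And>r. r0 \<le> r \<Longrightarrow> r < R \<Longrightarrow> (\<phi> has_real_derivative D r) (at r)"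
    and D: "\<And>r. r0 \<le> r \<Longrightarrow> r < R \<Longrightarrow> 0 \<le> D r"
    and le: "\<And>r. r0 \<le> r \<Longrightarrow> r < R \<Longrightarrow> h (\<phi> r) * D r \<le> C"
    and unb: "\<And>M. \<exists>r\<ge>r0. r < R \<and> M < \<phi> r"
  shows "(\<integral>\<^sup>+t\<in>{\<phi> r0..}. ennreal (h t) \<partial>lborel) < \<infinity>"
proof -
  obtain I where I: "\<And>x. \<tau> < x \<Longrightarrow> (I has_real_derivative h x) (at x)"
    using continuous_antiderivative[of "ereal \<tau>" h] h by auto
  have mono: "\<phi> r0 \<le> \<phi> r" if "r0 \<le> r" "r < R" for r
    using that \<phi> D by (intro deriv_nonneg_imp_mono[of r0 r \<phi> D]) auto
  have Imono: "I x \<le> I y" if "\<tau> < x" "x \<le> y" for x y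
    using that I h by (intro deriv_nonneg_imp_mono[of x y I h]) auto
  have 0: "C \<ge> 0" using le[of r0] h(3)[OF r0(2)] D[of r0] r0
    by (meson mult_nonneg_nonneg order_refl order_trans)
  have b: "I (\<phi> r) \<le> I (\<phi> r0) + C * (R - r0)" if r: "r0 \<le> r" "r < R" for r
  proof -
    have "I (\<phi> r) - C * r \<le> I (\<phi> r0) - C * r0"
    proof (rule DERIV_nonpos_imp_nonincreasing[OF r(1)])
      fix x assume x: "r0 \<le> x" "x \<le> r"
      have "((\<lambda>r. I (\<phi> r) - C * r) has_real_derivative h (\<phi> x) * D x - C) (at x)"
        using x r mono[of x] r0 by (intro DERIV_diff[OF DERIV_chain2[OF I \<phi>] DERIV_cmult_Id]) auto
      then show "\<exists>y. ((\<lambda>r. I (\<phi> r) - C * r) has_real_derivative y) (at x) \<and> y \<le> 0"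
        using le[of x] x r by force
    qed
    moreover have "C * r \<le> C * R" using 0 r by (intro mult_left_mono) auto
    ultimately show ?thesis by (simp add: algebra_simps)
  qed
  show ?thesis
  proof (rule nn_integral_atLeast_finite[OF h(1)])
    fix x assume x: "\<phi> r0 \<le> x"
    obtain r where r: "r \<ge> r0" "r < R" "x < \<phi> r" using unb by blast
    have "I x \<le> I (\<phi> r)" using x r r0 by (intro Imono) auto
    then show "I x \<le> I (\<phi> r0) + C * (R - r0)" using b[of r] r by simp
  qed (use r0 h I in auto)
qed

text \<open>The counterpart for solutions that exist for all \<open>r\<close>: now
  \<open>I \<circ> \<phi>\<close> grows at least at the rate \<open>C\<close>, so \<open>I\<close>
  is unbounded.\<close>

lemma global_integral_infinite:
  fixes \<phi> D h :: "real \<Rightarrow> real"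
  assumes h: "h \<in> borel_measurable borel" "\<And>t. \<tau> < t \<Longrightarrow> isCont h t" "\<And>t. \<tau> < t \<Longrightarrow> 0 \<le> h t"
    and r0: "\<tau> < \<phi> r0"
    and \<phi>: "\<And>r. r0 \<le> r \<Longrightarrow> (\<phi> has_real_derivative D r) (at r)"
    and D: "\<And>r. r0 \<le> r \<Longrightarrow> 0 \<le> D r"
    and ge: "\<And>r. r0 \<le> r \<Longrightarrow> C \<le> h (\<phi> r) * D r" and C: "C > 0"
  shows "(\<integral>\<^sup>+t\<in>{\<phi> r0..}. ennreal (h t) \<partial>lborel) = \<infinity>"
proof -
  obtain I where I: "\<And>x. \<tau> < x \<Longrightarrow> (I has_real_derivative h x) (at x)"
    using continuous_antiderivative[of "ereal \<tau>" h] h by auto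
  have mono: "\<phi> r0 \<le> \<phi> r" if "r0 \<le> r" for r
    using that \<phi> D by (intro deriv_nonneg_imp_mono[of r0 r \<phi> D]) auto
  have b: "I (\<phi> r0) + C * (r - r0) \<le> I (\<phi> r)" if r: "r0 \<le> r" for r
  proof -
    have "I (\<phi> r0) - C * r0 \<le> I (\<phi> r) - C * r"
    proof (rule DERIV_nonneg_imp_nondecreasing[OF r(1)])
      fix x assume x: "r0 \<le> x" "x \<le> r"
      have "((\<lambda>r. I (\<phi> r) - C * r) has_real_derivative h (\<phi> x) * D x - C) (at x)"
        using x r mono[of x] r0 by (intro DERIV_diff[OF DERIV_chain2[OF I \<phi>] DERIV_cmult_Id]) auto
      then show "\<exists>y. ((\<lambda>r. I (\<phi> r) - C * r) has_real_derivative y) (at x) \<and> 0 \<le> y"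
        using ge[of x] x r by force
    qed
    then show ?thesis by (simp add: algebra_simps)
  qed
  show ?thesis
  proof (rule nn_integral_atLeast_infinite[OF h(1)])
    fix M
    define r where "r = r0 + \<bar>M - I (\<phi> r0)\<bar> / C"
    have "r0 \<le> r" using C by (simp add: r_def)
    moreover have "M \<le> I (\<phi> r)" using b[OF \<open>r0 \<le> r\<close>] C by (auto simp: r_def)
    ultimately show "\<exists>x\<ge>\<phi> r0. M \<le> I x" using mono by blast
  qed (use r0 h I in auto)
qed

section \<open>Local existence\<close>

text \<open>
  Since \<open>G\<close> is monotone, the Picard iteration started from the constant \<open>p / 2\<close> is increasing; its
  pointwise limit is a fixed point by dominated convergence, so no Lipschitz condition is needed.
\<close>

lemma monotone_second_order_ivp:
  fixes G :: "real \<Rightarrow> real \<Rightarrow> real \<Rightarrow> real" and b p s \<kappa> :: real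
  assumes p: "p > 0" and \<kappa>: "\<kappa> \<ge> 0"
    and cont: "continuous_on ({s..s+1} \<times> {b..b+1} \<times> {p/2..2*p}) (\<lambda>(r, x, y). G r x y)"
    and mono: "\<And>r x y x' y'. \<lbrakk>s \<le> r; r \<le> s + 1; b \<le> x; x \<le> x'; x' \<le> b + 1; p / 2 \<le> y; y \<le> y'; y' \<le> 2 * p\<rbrakk>
       \<Longrightarrow> G r x y \<le> G r x' y'"
  obtains \<epsilon> u v where "\<epsilon> > 0" "u s = b" "v s = p"
    "\<And>r. r \<in> {s..s+\<epsilon>} \<Longrightarrow> (u has_real_derivative v r) (at r within {s..s+\<epsilon>})"
    "\<And>r. r \<in> {s..s+\<epsilon>} \<Longrightarrow> (v has_real_derivative G r (u r) (v r) - \<kappa> * v r) (at r within {s..s+\<epsilon>})"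
    "\<And>r. r \<in> {s..s+\<epsilon>} \<Longrightarrow> p / 2 \<le> v r"
proof -
  let ?S = "{s..s+1} \<times> {b..b+1} \<times> {p/2..2*p}"
  have "bounded ((\<lambda>(r, x, y). G r x y) ` ?S)"
    by (intro compact_imp_bounded compact_continuous_image cont compact_Times compact_Icc)
  then obtain B where B0: "B > 0" and B': "\<forall>z\<in>(\<lambda>(r, x, y). G r x y) ` ?S. norm z \<le> B"
    by (auto simp: bounded_pos)
  have B: "\<bar>G r x y\<bar> \<le> B" if "r \<in> {s..s+1}" "x \<in> {b..b+1}" "y \<in> {p/2..2*p}" for r x y
  proof -
    have "G r x y \<in> (\<lambda>(r, x, y). G r x y) ` ?S"
      using that by (intro image_eqI[of _ _ "(r, x, y)"]) auto
    with B' show ?thesis by auto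
  qed
  \<comment> \<open>The four bounds keep \<open>r\<close> in \<open>{s..s+1}\<close>, keep
    \<open>U w\<close> in \<open>{b..b+1}\<close>, keep the integral of \<open>H w\<close> within
    \<open>p / 4\<close>, and keep \<open>exp (- \<kappa> * t)\<close> above 3/4 and
    \<open>exp (\<kappa> * t)\<close> below 2.\<close>
  define \<epsilon> where "\<epsilon> = Min {1, 1 / (2 * p), p / (8 * B), 1 / (4 * (\<kappa> + 1))}"
  have \<epsilon>_le: "\<epsilon> \<le> 1" "\<epsilon> \<le> 1 / (2 * p)" "\<epsilon> \<le> p / (8 * B)" "\<epsilon> \<le> 1 / (4 * (\<kappa> + 1))"
    unfolding \<epsilon>_def by (intro Min_le; simp)+
  have \<epsilon>0: "\<epsilon> > 0" unfolding \<epsilon>_def using p B0 \<kappa> by (subst Min_gr_iff) auto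
  have \<epsilon>1: "2 * p * \<epsilon> \<le> 1" "2 * B * \<epsilon> \<le> p / 4" "\<kappa> * \<epsilon> \<le> 1 / 4"
  proof -
    show "2 * p * \<epsilon> \<le> 1" "2 * B * \<epsilon> \<le> p / 4"
      using \<epsilon>_le p B0 by (auto simp: field_simps)
    have "(\<kappa> + 1) * \<epsilon> \<le> 1 / 4" using \<epsilon>_le(4) \<kappa> by (auto simp: field_simps)
    then show "\<kappa> * \<epsilon> \<le> 1 / 4" using \<epsilon>0 by (simp add: algebra_simps)
  qed
  have exp_ge: "3 / 4 \<le> exp (- \<kappa> * t)" and exp_le: "exp (\<kappa> * t) \<le> 2"
    if "0 \<le> t" "t \<le> \<epsilon>" for t
  proof -
    have "\<kappa> * t \<le> \<kappa> * \<epsilon>" using that \<kappa> by (intro mult_left_mono) auto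
    then have "\<kappa> * t \<le> 1 / 4" using \<epsilon>1 by simp
    then show 1: "3 / 4 \<le> exp (- \<kappa> * t)" using exp_ge_add_one_self[of "- \<kappa> * t"] by simp
    have "0 \<le> \<kappa> * t" using that \<kappa> by simp
    moreover have "(\<kappa> * t)\<^sup>2 \<le> (1 / 4)\<^sup>2"
      using \<open>\<kappa> * t \<le> 1 / 4\<close> \<open>0 \<le> \<kappa> * t\<close> by (intro power_mono)
    ultimately show "exp (\<kappa> * t) \<le> 2"
      using exp_bound[of "\<kappa> * t"] \<open>\<kappa> * t \<le> 1 / 4\<close> by (simp add: power2_eq_square)
  qed
  define J where "J = {s..s+\<epsilon>}"
  \<comment> \<open>A fixed point \<open>w\<close> of \<open>T\<close> is the sought
    \<open>v\<close>, and \<open>U w\<close> is the sought \<open>u\<close>. The exponential factors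
    take care of the term \<open>- \<kappa> * v\<close>, so that what remains under the integral is
    nondecreasing in \<open>w\<close>.\<close>
  define U where "U = (\<lambda>w r. b + integral {s..r} w)"
  define H where "H = (\<lambda>w t. exp (\<kappa> * (t - s)) * G t (U w t) (w t))"
  define T where "T = (\<lambda>w r. exp (- \<kappa> * (r - s)) * (p + integral {s..r} (H w)))"
  define Rng where "Rng = (\<lambda>w. \<forall>r\<in>J. p / 2 \<le> w r \<and> w r \<le> 2 * p)"
  define Inv where "Inv = (\<lambda>w. continuous_on J w \<and> Rng w)"
  have sub: "{s..r} \<subseteq> J" if "r \<in> J" for r using that by (auto simp: J_def)
  have U_range: "U w r \<in> {b..b+1}" if w: "w integrable_on J" "Rng w" and r: "r \<in> J" for w r
  proof -
    have i: "w integrable_on {s..r}" using w(1) sub[OF r]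
      by (rule integrable_subinterval_real[of w s "s+\<epsilon>", folded J_def])
    have "integral {s..r} (\<lambda>_. p / 2) \<le> integral {s..r} w"
      using w(2) sub[OF r] by (intro integral_le i) (auto simp: Rng_def)
    moreover have "integral {s..r} w \<le> integral {s..r} (\<lambda>_. 2 * p)"
      using w(2) sub[OF r] by (intro integral_le i) (auto simp: Rng_def)
    moreover have "0 \<le> (r - s) * (p / 2)" using p r by (auto simp: J_def)
    moreover have "(r - s) * (2 * p) \<le> \<epsilon> * (2 * p)" using p r by (intro mult_right_mono) (auto simp: J_def)
    ultimately show ?thesis using \<epsilon>1 r by (auto simp: U_def J_def algebra_simps)
  qed
  have U_cont: "continuous_on J (U w)" if "w integrable_on J" for w
    using that unfolding U_def J_def by (intro continuous_intros indefinite_integral_continuous_1)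
  have Hcont: "continuous_on J (H w)" if "Inv w" for w
  proof -
    have w: "continuous_on J w" "Rng w" "w integrable_on J"
      using that by (auto simp: Inv_def J_def intro!: integrable_continuous_real)
    have "continuous_on J (\<lambda>t. (\<lambda>(r, x, y). G r x y) (t, U w t, w t))"
      by (rule continuous_on_compose2[OF cont])
        (use w \<epsilon>_le U_range[OF w(3,2)] U_cont[OF w(3)] in \<open>auto intro!: continuous_intros simp: Rng_def J_def\<close>)
    then show ?thesis unfolding H_def by (auto intro!: continuous_intros)
  qed
  have Hbd: "\<bar>H w r\<bar> \<le> 2 * B" if "w integrable_on J" "Rng w" "r \<in> J" for w r
  proof -
    have "\<bar>G r (U w r) (w r)\<bar> \<le> B"
      using U_range[OF that] that \<epsilon>_le by (intro B) (auto simp: J_def Rng_def)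
    moreover have "exp (\<kappa> * (r - s)) \<le> 2" using exp_le[of "r - s"] that by (auto simp: J_def)
    ultimately show ?thesis unfolding H_def abs_mult by (intro mult_mono) auto
  qed
  have InvT: "Inv (T w)" if iw: "Inv w" for w
  proof -
    have w: "continuous_on J w" "Rng w" "w integrable_on J"
      using iw by (auto simp: Inv_def J_def intro!: integrable_continuous_real)
    have Hi: "H w integrable_on J" using Hcont[OF iw] by (auto simp: J_def intro!: integrable_continuous_real)
    have "continuous_on J (T w)"
      unfolding T_def using Hi unfolding J_def by (intro continuous_intros indefinite_integral_continuous_1)
    moreover have "p / 2 \<le> T w r \<and> T w r \<le> 2 * p" if r: "r \<in> J" for r
    proof -
      have "\<bar>integral {s..r} (H w)\<bar> \<le> 2 * B * (r - s)"
        using integral_bound[of s r "H w" "2 * B"] r Hbd[OF w(3,2)] sub[OF r]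
          continuous_on_subset[OF Hcont[OF iw] sub[OF r]] by (auto simp: J_def)
      also have "\<dots> \<le> 2 * B * \<epsilon>" using r B0 by (intro mult_left_mono) (auto simp: J_def)
      finally have *: "\<bar>integral {s..r} (H w)\<bar> \<le> p / 4" using \<epsilon>1 by simp
      have e: "3 / 4 \<le> exp (- \<kappa> * (r - s))" "exp (- \<kappa> * (r - s)) \<le> 1"
        using exp_ge[of "r - s"] r \<kappa> by (auto simp: J_def)
      \<comment> \<open>The product 9/16 still exceeds 1/2, as the lower end of the range
        requires.\<close>
      have "3 / 4 * (3 / 4 * p) \<le> T w r"
        unfolding T_def using e * p by (intro mult_mono) auto
      moreover have "T w r \<le> 1 * (2 * p)"
        unfolding T_def using e * p by (intro mult_mono) auto
      ultimately show ?thesis using p by auto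
    qed
    ultimately show ?thesis by (auto simp: Inv_def Rng_def)
  qed
  have Tmono: "T w r \<le> T w' r" if w: "Inv w" "Inv w'" and le: "\<And>r. r \<in> J \<Longrightarrow> w r \<le> w' r" and r: "r \<in> J" for w w' r
  proof -
    have i: "w integrable_on {s..r}" "w' integrable_on {s..r}" if "r \<in> J" for r
      using w continuous_on_subset[OF _ sub[OF that]] by (auto simp: Inv_def intro!: integrable_continuous_real)
    have i': "w integrable_on J" "w' integrable_on J"
      using i[of "s+\<epsilon>"] \<epsilon>0 by (auto simp: J_def)
    have R: "Rng w" "Rng w'" using w by (auto simp: Inv_def)
    have UU: "U w r \<le> U w' r" if "r \<in> J" for r
      unfolding U_def using le sub[OF that] by (intro add_left_mono integral_le i[OF that]) auto
    have "H w t \<le> H w' t" if t: "t \<in> J" for t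
      unfolding H_def using U_range[OF i'(1) R(1) t] U_range[OF i'(2) R(2) t] UU[OF t] le[OF t] R t \<epsilon>_le
      by (intro mult_left_mono mono) (auto simp: Rng_def J_def)
    then have "integral {s..r} (H w) \<le> integral {s..r} (H w')"
      using sub[OF r] continuous_on_subset[OF Hcont[OF w(1)] sub[OF r]] continuous_on_subset[OF Hcont[OF w(2)] sub[OF r]]
      by (intro integral_le) (auto intro!: integrable_continuous_real)
    then show ?thesis unfolding T_def by (intro mult_left_mono) auto
  qed
  define V where "V = (\<lambda>n. (T ^^ n) (\<lambda>_. p / 2))"
  have V_Suc: "V (Suc n) = T (V n)" for n by (simp add: V_def)
  have VInv: "Inv (V n)" for n
    by (induction n) (use p InvT in \<open>auto simp: V_def Inv_def Rng_def\<close>)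
  have Vinc: "V n r \<le> V (Suc n) r" if "r \<in> J" for n r
    using that
  proof (induction n arbitrary: r)
    case 0
    then show ?case using VInv[of 1] by (auto simp: V_def Inv_def Rng_def)
  next
    case (Suc n)
    then have "\<And>r. r \<in> J \<Longrightarrow> V n r \<le> T (V n) r" by (simp add: V_Suc)
    then show ?case unfolding V_Suc[of "Suc n"] unfolding V_Suc[of n]
      using VInv InvT \<open>r \<in> J\<close> by (intro Tmono) auto
  qed
  have Vrng: "p / 2 \<le> V n r" "V n r \<le> 2 * p" if "r \<in> J" for n r
    using VInv[of n] that by (auto simp: Inv_def Rng_def)
  define v where "v = (\<lambda>r. lim (\<lambda>n. V n r))"
  have lim: "(\<lambda>n. V n r) \<longlonglongrightarrow> v r" if "r \<in> J" for r
  proof -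
    have "incseq (\<lambda>n. V n r)" by (intro incseq_SucI Vinc that)
    then have "convergent (\<lambda>n. V n r)"
      using Vrng[OF that] by (metis incseq_convergent convergentI)
    then show ?thesis unfolding v_def by (simp add: convergent_LIMSEQ_iff)
  qed
  have vrng: "Rng v"
    unfolding Rng_def using lim Vrng by (meson LIMSEQ_le_const LIMSEQ_le_const2)
  have Vint: "V n integrable_on {s..r}" if "r \<in> J" for n r
    using VInv[of n] continuous_on_subset[OF _ sub[OF that]] by (auto simp: Inv_def intro!: integrable_continuous_real)
  have dom1: "v integrable_on {s..r}" "(\<lambda>n. integral {s..r} (V n)) \<longlonglongrightarrow> integral {s..r} v" if "r \<in> J" for r
  proof -
    have *: "norm (V k x) \<le> 2 * p" if "x \<in> {s..r}" for k x
      using that Vrng[of x k] sub[OF \<open>r \<in> J\<close>] p by (auto simp: abs_if)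
    show "v integrable_on {s..r}" "(\<lambda>n. integral {s..r} (V n)) \<longlonglongrightarrow> integral {s..r} v"
      by (rule dominated_convergence[of V "{s..r}" "\<lambda>_. 2 * p" v];
          use Vint[OF that] * lim sub[OF that] in auto)+
  qed
  have vint: "v integrable_on J" using dom1(1)[of "s+\<epsilon>"] \<epsilon>0 by (auto simp: J_def)
  have limU: "(\<lambda>n. U (V n) r) \<longlonglongrightarrow> U v r" if "r \<in> J" for r
    unfolding U_def by (intro tendsto_intros dom1 that)
  have VintJ: "V n integrable_on J" for n using Vint[of "s+\<epsilon>"] \<epsilon>0 by (auto simp: J_def)
  have VRng: "Rng (V n)" for n using VInv[of n] by (auto simp: Inv_def)
  have limH: "(\<lambda>n. H (V n) r) \<longlonglongrightarrow> H v r" if "r \<in> J" for r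
  proof -
    have "(\<lambda>n. (\<lambda>(r, x, y). G r x y) (r, U (V n) r, V n r)) \<longlonglongrightarrow> (\<lambda>(r, x, y). G r x y) (r, U v r, v r)"
      using that U_range[OF VintJ VRng that] U_range[OF vint vrng that] vrng Vrng[OF that] \<epsilon>_le
      by (intro continuous_on_tendsto_compose[OF cont]) (auto intro!: tendsto_intros limU lim simp: Rng_def J_def)
    then show ?thesis unfolding H_def by (auto intro!: tendsto_intros)
  qed
  have dom2: "H v integrable_on {s..r}" "(\<lambda>n. integral {s..r} (H (V n))) \<longlonglongrightarrow> integral {s..r} (H v)" if "r \<in> J" for r
  proof -
    have *: "norm (H (V k) x) \<le> 2 * B" if "x \<in> {s..r}" for k x
      using Hbd[OF VintJ VRng] that sub[OF \<open>r \<in> J\<close>] by auto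
    have **: "H (V k) integrable_on {s..r}" for k
      using continuous_on_subset[OF Hcont[OF VInv] sub[OF that]] by (auto intro!: integrable_continuous_real)
    show "H v integrable_on {s..r}" "(\<lambda>n. integral {s..r} (H (V n))) \<longlonglongrightarrow> integral {s..r} (H v)"
      by (rule dominated_convergence[of "\<lambda>k. H (V k)" "{s..r}" "\<lambda>_. 2 * B" "H v"];
          use ** * limH sub[OF that] in auto)+
  qed
  have fix_v: "v r = T v r" if "r \<in> J" for r
  proof (rule LIMSEQ_unique)
    show "(\<lambda>n. V (Suc n) r) \<longlonglongrightarrow> v r" using lim[OF that] by (rule LIMSEQ_Suc)
    show "(\<lambda>n. V (Suc n) r) \<longlonglongrightarrow> T v r"
      unfolding V_Suc T_def by (intro tendsto_intros dom2 that)
  qed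
  \<comment> \<open>Pointwise convergence does not pass continuity on to \<open>v\<close>; the
    integral equation does.\<close>
  have "continuous_on J (T v)"
    unfolding T_def using dom2(1)[of "s+\<epsilon>"] \<epsilon>0 unfolding J_def
    by (intro continuous_intros indefinite_integral_continuous_1) auto
  then have vcont: "continuous_on J v" using fix_v by (simp cong: continuous_on_cong)
  then have vInv: "Inv v" using vrng by (simp add: Inv_def)
  note J = J_def[symmetric]
  show ?thesis
  proof (rule that[OF \<epsilon>0, of "U v" v, unfolded J])
    show "U v s = b" by (simp add: U_def)
    have "s \<in> J" using \<epsilon>0 by (simp add: J_def)
    then show "v s = p" using fix_v[of s] by (simp add: T_def)
    fix r assume r: "r \<in> J"
    show "(U v has_real_derivative v r) (at r within J)"
      unfolding U_def using integral_has_real_derivative[of s "s+\<epsilon>" v r] vcont r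
      by (auto intro!: derivative_eq_intros simp: J_def)
    have "(T v has_real_derivative - \<kappa> * T v r + exp (- \<kappa> * (r - s)) * H v r) (at r within J)"
      unfolding T_def using integral_has_real_derivative[of s "s+\<epsilon>" "H v" r] Hcont[OF vInv] r
      by (auto intro!: derivative_eq_intros simp: J_def algebra_simps)
    then have "(v has_real_derivative - \<kappa> * T v r + exp (- \<kappa> * (r - s)) * H v r) (at r within J)"
      unfolding has_field_derivative_def
      by (rule has_derivative_transform[OF r, rotated]) (simp add: fix_v)
    also have "exp (- \<kappa> * (r - s)) * H v r = G r (U v r) (v r)"
      by (simp add: H_def exp_minus mult.assoc[symmetric] flip: exp_add)
    finally show "(v has_real_derivative G r (U v r) (v r) - \<kappa> * v r) (at r within J)"
      using fix_v[OF r] by simp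
    show "p / 2 \<le> v r" using vrng r by (simp add: Rng_def)
  qed
qed

lemma powr_Lipschitz_on_Icc:
  fixes l u q :: real
  assumes "0 < l" "0 \<le> q"
  obtains L where "L \<ge> 0" "\<And>x y. l \<le> x \<Longrightarrow> x \<le> y \<Longrightarrow> y \<le> u \<Longrightarrow> y powr q - x powr q \<le> L * (y - x)"
proof
  \<comment> \<open>The derivative of \<open>x powr q\<close> increases or decreases according to
    the sign of \<open>q - 1\<close>; the sum of its values at both ends bounds it in either
    case.\<close>
  show "q * (l powr (q - 1) + u powr (q - 1)) \<ge> 0" using assms by simp
  fix x y assume xy: "l \<le> x" "x \<le> y" "y \<le> u"
  show "y powr q - x powr q \<le> q * (l powr (q - 1) + u powr (q - 1)) * (y - x)"
  proof (cases "x = y")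
    case False
    then have "x < y" using xy by simp
    have d: "((\<lambda>x. x powr q) has_real_derivative q * t powr (q - 1)) (at t)" if "x \<le> t" for t
      using that xy assms by (auto intro!: derivative_eq_intros)
    obtain z where z: "x < z" "z < y" "y powr q - x powr q = (y - x) * (q * z powr (q - 1))"
      using MVT2[OF \<open>x < y\<close>, of "\<lambda>x. x powr q" "\<lambda>t. q * t powr (q - 1)"] d by blast
    have "z powr (q - 1) \<le> l powr (q - 1) + u powr (q - 1)"
    proof (cases "q \<ge> 1")
      case True
      then have "z powr (q - 1) \<le> u powr (q - 1)" using z xy assms by (intro powr_mono2) auto
      then show ?thesis by (simp add: add_increasing)
    next
      case False
      then have "z powr (q - 1) \<le> l powr (q - 1)" using z xy assms by (intro powr_mono2') auto
      then show ?thesis by (simp add: add_increasing2)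
    qed
    then have "q * z powr (q - 1) * (y - x) \<le> q * (l powr (q - 1) + u powr (q - 1)) * (y - x)"
      using assms xy by (intro mult_right_mono mult_left_mono) auto
    then show ?thesis using z by (simp add: mult.commute)
  qed simp
qed

text \<open>Away from \<open>r = 0\<close> and \<open>y = 0\<close> the damping coefficient is
  bounded and \<open>y powr q\<close> is Lipschitz, so adding a large multiple
  \<open>\<kappa> * y\<close> makes the right-hand side nondecreasing in \<open>y\<close>. Negative
  values of \<open>g\<close> are harmless: \<open>y powr q\<close> is nonnegative, and
  \<open>g\<close> is at least \<open>g b\<close> on the box.\<close>

lemma radial_local_existence:
  fixes f g :: "real \<Rightarrow> real" and q c s b p :: real
  assumes q: "0 < q" and c: "c \<ge> 1" and f: "continuous_on UNIV f" "mono f"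
    and g: "continuous_on UNIV g" "mono g" and s: "s > 0" and p: "p > 0"
  obtains \<epsilon> u v where "\<epsilon> > 0" "u s = b" "v s = p"
    "\<And>r. r \<in> {s..s+\<epsilon>} \<Longrightarrow> (u has_real_derivative v r) (at r within {s..s+\<epsilon>})"
    "\<And>r. r \<in> {s..s+\<epsilon>} \<Longrightarrow>
       (v has_real_derivative f (u r) + g (u r) * \<bar>v r\<bar> powr q - (c - 1) / r * v r) (at r within {s..s+\<epsilon>})"
proof -
  obtain L where L: "L \<ge> 0" "\<And>x y. p / 2 \<le> x \<Longrightarrow> x \<le> y \<Longrightarrow> y \<le> 2 * p \<Longrightarrow> y powr q - x powr q \<le> L * (y - x)"
    using powr_Lipschitz_on_Icc[of "p / 2" q "2 * p"] p q by auto
  \<comment> \<open>large enough for \<open>G\<close> to be nondecreasing in \<open>y\<close>\<close>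
  define \<kappa> where "\<kappa> = (c - 1) / s + \<bar>g b\<bar> * L"
  define G where "G = (\<lambda>r x y. f x + g x * y powr q + (\<kappa> - (c - 1) / r) * y)"
  have \<kappa>: "\<kappa> \<ge> 0" using c s L by (simp add: \<kappa>_def)
  have fc: "continuous_on A (\<lambda>x. f (h x))" "continuous_on A (\<lambda>x. g (h x))"
    if "continuous_on A h" for A and h :: "real \<times> real \<times> real \<Rightarrow> real"
    using continuous_on_compose2[OF f(1) that] continuous_on_compose2[OF g(1) that] by auto
  have cont: "continuous_on ({s..s+1} \<times> {b..b+1} \<times> {p/2..2*p}) (\<lambda>(r, x, y). G r x y)"
    unfolding G_def split_def using s p q by (auto intro!: continuous_intros fc)
  have Gmono: "G r x y \<le> G r x' y'"
    if *: "s \<le> r" "r \<le> s + 1" "b \<le> x" "x \<le> x'" "x' \<le> b + 1" "p / 2 \<le> y" "y \<le> y'" "y' \<le> 2 * p" for r x y x' y'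
  proof -
    have "f x \<le> f x'" using monoD[OF f(2), of x x'] * by simp
    moreover have "g x * y powr q \<le> g x' * y powr q"
      using monoD[OF g(2), of x x'] * by (intro mult_right_mono) auto
    moreover have "- (\<bar>g b\<bar> * L * (y' - y)) \<le> g x' * (y' powr q - y powr q)"
    proof -
      have 1: "0 \<le> y' powr q - y powr q" using * p q by (auto intro!: powr_mono2)
      have "g b \<le> g x'" using monoD[OF g(2), of b x'] * by simp
      then have "- \<bar>g b\<bar> * (y' powr q - y powr q) \<le> g x' * (y' powr q - y powr q)"
        using 1 by (intro mult_right_mono) auto
      moreover have "\<bar>g b\<bar> * (y' powr q - y powr q) \<le> \<bar>g b\<bar> * (L * (y' - y))"
        using L(2) * by (intro mult_left_mono) auto
      ultimately show ?thesis by (simp add: mult.assoc)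
    qed
    moreover have "\<bar>g b\<bar> * L * (y' - y) \<le> (\<kappa> - (c - 1) / r) * (y' - y)"
    proof (rule mult_right_mono)
      have "(c - 1) / r \<le> (c - 1) / s" using * s c by (intro divide_left_mono) auto
      then show "\<bar>g b\<bar> * L \<le> \<kappa> - (c - 1) / r" by (simp add: \<kappa>_def)
    qed (use * in simp)
    ultimately show ?thesis unfolding G_def right_diff_distrib by linarith
  qed
  show ?thesis
  proof (rule monotone_second_order_ivp[OF p \<kappa> cont], goal_cases)
    case (1 r x y x' y')
    then show ?case by (intro Gmono)
  next
    case e: (2 \<epsilon> u v)
    show ?case
    proof (rule that[OF e(1-4)])
      fix r assume r: "r \<in> {s..s+\<epsilon>}"
      have "G r (u r) (v r) - \<kappa> * v r = f (u r) + g (u r) * \<bar>v r\<bar> powr q - (c - 1) / r * v r"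
        using e(6)[OF r] p by (simp add: G_def algebra_simps)
      then show "(v has_real_derivative f (u r) + g (u r) * \<bar>v r\<bar> powr q - (c - 1) / r * v r) (at r within {s..s+\<epsilon>})"
        using e(5)[OF r] by simp
    qed auto
  qed
qed

text \<open>On the left, L'Hopital's rule turns the limit of \<open>A'\<close> into a one-sided
  derivative, which agrees with that of \<open>B\<close> on the right. It is applied at the end of
  the existence interval, both to the solution and to its derivative.\<close>

lemma has_real_derivative_glue:
  fixes A A' B :: "real \<Rightarrow> real"
  assumes "s < \<rho>"
    and A: "\<And>r. s < r \<Longrightarrow> r < \<rho> \<Longrightarrow> (A has_real_derivative A' r) (at r)"
    and "(A \<longlongrightarrow> B \<rho>) (at_left \<rho>)" "(A' \<longlongrightarrow> B') (at_left \<rho>)"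
    and B: "(B has_real_derivative B') (at \<rho> within {\<rho>..\<rho> + \<epsilon>})" and "\<epsilon> > 0"
  shows "((\<lambda>r. if r < \<rho> then A r else B r) has_real_derivative B') (at \<rho>)"
proof -
  let ?F = "\<lambda>r. if r < \<rho> then A r else B r"
  have "((\<lambda>r. (A r - B \<rho>) / (r - \<rho>)) \<longlongrightarrow> B') (at_left \<rho>)"
  proof (rule lhopital_left[where f' = A' and g' = "\<lambda>_. 1"])
    show "((\<lambda>r. A r - B \<rho>) \<longlongrightarrow> 0) (at_left \<rho>)" "((\<lambda>r. r - \<rho>) \<longlongrightarrow> 0) (at_left \<rho>)"
      using assms by (auto intro!: tendsto_eq_intros)
    show "\<forall>\<^sub>F x in at_left \<rho>. ((\<lambda>r. A r - B \<rho>) has_real_derivative A' x) (at x)"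
      unfolding eventually_at_left_field
      by (intro exI[of _ s]) (use assms in \<open>auto intro!: derivative_eq_intros\<close>)
    show "\<forall>\<^sub>F x in at_left \<rho>. ((\<lambda>r. r - \<rho>) has_real_derivative 1) (at x)"
      by (auto intro!: derivative_eq_intros always_eventually)
    show "((\<lambda>x. A' x / 1) \<longlongrightarrow> B') (at_left \<rho>)" using assms by simp
  qed (auto simp: eventually_at_filter)
  then have 1: "((\<lambda>r. (?F r - ?F \<rho>) / (r - \<rho>)) \<longlongrightarrow> B') (at_left \<rho>)"
    by (rule Lim_transform_eventually) (auto simp: eventually_at_filter)
  have "((\<lambda>r. (B r - B \<rho>) / (r - \<rho>)) \<longlongrightarrow> B') (at_right \<rho>)"
    using B \<open>\<epsilon> > 0\<close> by (simp add: has_field_derivative_iff at_within_Icc_at_right)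
  then have 2: "((\<lambda>r. (?F r - ?F \<rho>) / (r - \<rho>)) \<longlongrightarrow> B') (at_right \<rho>)"
    by (rule Lim_transform_eventually) (auto simp: eventually_at_filter)
  show ?thesis
    unfolding has_field_derivative_iff using filterlim_split_at[OF 1 2] .
qed

section \<open>Convexity and continuation of solutions\<close>

locale radial_solution =
  fixes f g :: "real \<Rightarrow> real" and q c a :: real and \<phi> :: "real \<Rightarrow> real" and R :: ereal
  assumes q: "0 < q" "q \<le> 2" and c: "c \<ge> 1"
    and f_cont: "continuous_on UNIV f" and f_mono: "mono f" and f_pos: "\<And>t. f t > 0"
    and g_cont: "continuous_on UNIV g" and g_mono: "mono g"
    and sol: "cauchy_solution f g c q a \<phi> R"
begin

abbreviation D :: "real \<Rightarrow> real" where "D \<equiv> deriv \<phi>"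

lemma dom_le: "ereal r < R \<Longrightarrow> s \<le> r \<Longrightarrow> ereal s < R"
  by (rule le_less_trans[of _ "ereal r"]) simp_all

lemma f_tendsto: "(h \<longlongrightarrow> l) F \<Longrightarrow> ((\<lambda>x. f (h x)) \<longlongrightarrow> f l) F" for h :: "'b \<Rightarrow> real"
  using continuous_on_tendsto_compose[OF f_cont _ UNIV_I, of h l F] by simp

lemma g_tendsto: "(h \<longlongrightarrow> l) F \<Longrightarrow> ((\<lambda>x. g (h x)) \<longlongrightarrow> g l) F" for h :: "'b \<Rightarrow> real"
  using continuous_on_tendsto_compose[OF g_cont _ UNIV_I, of h l F] by simp

lemma \<phi>_deriv: "0 < r \<Longrightarrow> ereal r < R \<Longrightarrow> (\<phi> has_real_derivative D r) (at r)"
  using sol by (auto simp: cauchy_solution_def DERIV_deriv_iff_real_differentiable)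

lemma D_deriv: "0 < r \<Longrightarrow> ereal r < R \<Longrightarrow> (D has_real_derivative deriv D r) (at r)"
  using sol by (auto simp: cauchy_solution_def DERIV_deriv_iff_real_differentiable)

lemma ode: "0 < r \<Longrightarrow> ereal r < R \<Longrightarrow>
   deriv D r = f (\<phi> r) + g (\<phi> r) * \<bar>D r\<bar> powr q - (c - 1) / r * D r"
proof -
  assume r: "0 < r" "ereal r < R"
  have "\<forall>r. 0 < r \<and> ereal r < R \<longrightarrow>
      deriv D r + (c - 1) / r * D r = f (\<phi> r) + g (\<phi> r) * \<bar>D r\<bar> powr q"
    using sol unfolding cauchy_solution_def by blast
  with r have "deriv D r + (c - 1) / r * D r = f (\<phi> r) + g (\<phi> r) * \<bar>D r\<bar> powr q"
    by blast
  then show ?thesis by linarith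
qed

lemma R_pos: "0 < R" and D_lim_0: "(D \<longlongrightarrow> 0) (at_right 0)"
  using sol by (auto simp: cauchy_solution_def)

lemma obtain_radius: obtains \<rho> where "0 < \<rho>" "ereal \<rho> < R"
proof -
  obtain \<rho> where "0 < ereal \<rho>" "ereal \<rho> < R" using ereal_dense2[OF R_pos] by blast
  then show ?thesis using that by simp
qed

lemma \<phi>_lim_0: "(\<phi> \<longlongrightarrow> a) (at_right 0)"
proof -
  obtain \<rho> where \<rho>: "0 < \<rho>" "ereal \<rho> < R" by (rule obtain_radius)
  have "continuous_on {r. 0 \<le> r \<and> ereal r < R} \<phi>" "\<phi> 0 = a"
    using sol by (auto simp: cauchy_solution_def)
  then have "continuous_on {0..\<rho>} \<phi>"
    by (elim continuous_on_subset) (use \<rho> dom_le in auto)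
  then have "(\<phi> \<longlongrightarrow> \<phi> 0) (at 0 within {0..\<rho>})"
    using \<rho> by (auto simp: continuous_on_def)
  then show ?thesis using \<rho> \<open>\<phi> 0 = a\<close> by (simp add: at_within_Icc_at_right)
qed

text \<open>The definition of a solution leaves the value \<open>L\<close> of this limit open. By
  L'Hopital's rule \<open>D r / r\<close> tends to the same \<open>L\<close>, and the equation gives
  \<open>L + (c - 1) * L = f a\<close>.\<close>

lemma D2_lim_0: "(deriv D \<longlongrightarrow> f a / c) (at_right 0)"
proof -
  obtain \<rho> where \<rho>: "0 < \<rho>" "ereal \<rho> < R" by (rule obtain_radius)
  have ev: "\<forall>\<^sub>F r in at_right 0. 0 < r \<and> ereal r < R"
    unfolding eventually_at_right_field using \<rho> dom_le by (intro exI[of _ \<rho>]) auto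
  obtain L where L: "(deriv D \<longlongrightarrow> L) (at_right 0)"
    using sol by (auto simp: cauchy_solution_def)
  have Dr: "((\<lambda>r. D r / r) \<longlongrightarrow> L) (at_right 0)"
  proof (rule lhopital_right[where f' = "deriv D" and g' = "\<lambda>_. 1"])
    show "\<forall>\<^sub>F x in at_right 0. (D has_real_derivative deriv D x) (at x)"
      using ev by eventually_elim (use D_deriv in auto)
    show "((\<lambda>r. r) \<longlongrightarrow> 0) (at_right (0::real))" by (auto intro!: tendsto_eq_intros)
    show "\<forall>\<^sub>F x in at_right 0. ((\<lambda>r. r) has_real_derivative 1) (at x)"
      by (auto intro!: derivative_eq_intros always_eventually)
  qed (use L D_lim_0 in \<open>auto simp: eventually_at_filter\<close>)
  have "((\<lambda>r. deriv D r + (c - 1) * (D r / r)) \<longlongrightarrow> L + (c - 1) * L) (at_right 0)"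
    by (intro tendsto_intros L Dr)
  moreover have "((\<lambda>r. \<bar>D r\<bar> powr q) \<longlongrightarrow> 0) (at_right 0)"
    by (rule tendsto_zero_powrI[where b = q]) (use D_lim_0 q in \<open>auto simp: tendsto_rabs_zero_iff\<close>)
  then have "((\<lambda>r. f (\<phi> r) + g (\<phi> r) * \<bar>D r\<bar> powr q) \<longlongrightarrow> f a + g a * 0) (at_right 0)"
    by (intro tendsto_intros f_tendsto g_tendsto \<phi>_lim_0)
  then have "((\<lambda>r. deriv D r + (c - 1) * (D r / r)) \<longlongrightarrow> f a + g a * 0) (at_right 0)"
    by (rule Lim_transform_eventually) (use ev in eventually_elim, simp add: ode)
  ultimately have "L + (c - 1) * L = f a + g a * 0"
    by (intro tendsto_unique[where F = "at_right (0::real)"]) auto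
  then have "L = f a / c" using c by (simp add: field_simps)
  then show ?thesis using L by simp
qed

lemma D_cont: "0 < r \<Longrightarrow> ereal r < R \<Longrightarrow> isCont D r"
  and \<phi>_cont: "0 < r \<Longrightarrow> ereal r < R \<Longrightarrow> isCont \<phi> r"
  using D_deriv \<phi>_deriv DERIV_isCont by blast+

lemma D2_pos_imp_D_pos:
  assumes pos: "\<And>x. 0 < x \<Longrightarrow> x < r \<Longrightarrow> deriv D x > 0" and r: "0 < r" "ereal r < R"
  shows "D r > 0"
proof -
  have less: "D x < D y" if "0 < x" "x < y" "y \<le> r" for x y
  proof (rule DERIV_pos_imp_increasing_open[OF \<open>x < y\<close>])
    show "\<exists>d. (D has_real_derivative d) (at z) \<and> 0 < d" if "x < z" "z < y" for z
      using D_deriv[of z] pos[of z] dom_le[OF r(2), of z] that \<open>0 < x\<close> \<open>y \<le> r\<close> by auto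
    show "continuous_on {x..y} D"
      by (rule continuous_at_imp_continuous_on) (use that r dom_le[OF r(2)] in \<open>auto intro!: D_cont\<close>)
  qed
  have "0 \<le> D (r / 2)"
  proof (rule tendsto_upperbound[OF D_lim_0])
    show "\<forall>\<^sub>F x in at_right 0. D x \<le> D (r / 2)"
      unfolding eventually_at_right_field
      by (intro exI[of _ "r / 2"]) (use r less in \<open>force intro: less_imp_le\<close>)
  qed simp
  with less[of "r / 2" r] r show ?thesis by simp
qed

text \<open>
  At a first zero \<open>r0\<close> of \<open>\<phi>''\<close>, monotonicity gives \<open>\<phi>'' \<le> C (\<phi>'(r0) - \<phi>')\<close> to the left of \<open>r0\<close>,
  and a backward Gronwall argument forces \<open>\<phi>'\<close> to be constant there.
\<close>

lemma D2_pos: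
  assumes "0 < r" "ereal r < R" shows "deriv D r > 0"
proof (rule ccontr)
  assume "\<not> deriv D r > 0"
  define S where "S = {x. 0 < x \<and> x \<le> r \<and> deriv D x \<le> 0}"
  have rS: "r \<in> S" using assms \<open>\<not> deriv D r > 0\<close> by (auto simp: S_def)
  have "f a / c > 0" using f_pos c by simp
  then have "\<forall>\<^sub>F x in at_right 0. deriv D x > 0"
    using order_tendstoD(1)[OF D2_lim_0] by blast
  then obtain d where d: "d > 0" "\<And>x. 0 < x \<Longrightarrow> x < d \<Longrightarrow> deriv D x > 0"
    by (auto simp: eventually_at_right_field)
  have dS: "d \<le> x" if "x \<in> S" for x using d(2)[of x] that by (force simp: S_def)
  have bdd: "bdd_below S" using dS by (auto simp: bdd_below_def)
  define r0 where "r0 = Inf S"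
  have r0: "d \<le> r0" "r0 \<le> r"
    unfolding r0_def using rS dS bdd by (auto intro: cInf_lower cInf_greatest)
  have dom: "0 < x \<and> ereal x < R" if "0 < x" "x \<le> r" for x using that dom_le assms by auto
  have cont2: "continuous_on {d..r} (deriv D)"
  proof -
    have "continuous_on {r. 0 < r \<and> ereal r < R} (deriv D)" using sol by (auto simp: cauchy_solution_def)
    then show ?thesis by (rule continuous_on_subset) (use d dom in auto)
  qed
  have "S = {d..r} \<inter> deriv D -` {..0}" using dS d by (auto simp: S_def)
  moreover have "closed ({d..r} \<inter> deriv D -` {..0})"
    by (intro continuous_closed_preimage cont2) auto
  ultimately have "r0 \<in> S" unfolding r0_def using bdd rS by (metis closed_contains_Inf empty_iff)
  then have le0: "deriv D r0 \<le> 0" by (simp add: S_def)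
  have pos: "deriv D x > 0" if "0 < x" "x < r0" for x
  proof (rule ccontr)
    assume "\<not> deriv D x > 0"
    then have "x \<in> S" using that r0 by (auto simp: S_def)
    then have "r0 \<le> x" unfolding r0_def by (intro cInf_lower bdd)
    then show False using that by simp
  qed
  have r00: "0 < r0" using r0 d by simp
  let ?m = "r0 / 2"
  have Dpos: "D x > 0" if "0 < x" "x \<le> r0" for x
    using D2_pos_imp_D_pos[of x] pos that dom[of x] r0 by auto
  have Dmono: "D x \<le> D y" if "0 < x" "x \<le> y" "y \<le> r0" for x y
  proof (rule DERIV_nonneg_imp_increasing_open[OF that(2)])
    show "\<exists>d. (D has_real_derivative d) (at z) \<and> 0 \<le> d" if "x < z" "z < y" for z
      using D_deriv[of z] pos[of z] dom[of z] that \<open>0 < x\<close> \<open>y \<le> r0\<close> r0 by (auto intro: less_imp_le)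
    show "continuous_on {x..y} D"
      by (rule continuous_at_imp_continuous_on) (use that r0 dom in \<open>auto intro!: D_cont\<close>)
  qed
  have \<phi>mono: "\<phi> x \<le> \<phi> y" if "0 < x" "x \<le> y" "y \<le> r0" for x y
    using that r0 dom Dpos by (intro deriv_nonneg_imp_mono[of x y \<phi> D] \<phi>_deriv) (auto intro: less_imp_le)
  \<comment> \<open>Starting at \<open>?m\<close> instead of 0 keeps \<open>D\<close> away from 0,
    where \<open>powr q\<close> is not Lipschitz if \<open>q < 1\<close>.\<close>
  obtain L where L: "L \<ge> 0" "\<And>x y. D ?m \<le> x \<Longrightarrow> x \<le> y \<Longrightarrow> y \<le> D r0 \<Longrightarrow> y powr q - x powr q \<le> L * (y - x)"
    using powr_Lipschitz_on_Icc[of "D ?m" q "D r0"] Dpos[of ?m] r00 q by auto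
  define C where "C = \<bar>g (\<phi> r0)\<bar> * L + (c - 1) / r0"
  \<comment> \<open>On passing from \<open>x\<close> to \<open>r0\<close>, the values
    \<open>f (\<phi> x)\<close> and \<open>g (\<phi> x)\<close> and the coefficient
    \<open>- (c - 1) / x\<close> do not decrease. The remaining changes, in
    \<open>D x powr q\<close> and in the factor \<open>D x\<close> of the damping term, cost at most
    a multiple of \<open>D r0 - D x\<close>.\<close>
  have le: "deriv D x \<le> C * (D r0 - D x)" if x: "?m \<le> x" "x \<le> r0" for x
  proof -
    have 0: "0 < x" using x r00 by simp
    have p: "\<bar>D x\<bar> = D x" "\<bar>D r0\<bar> = D r0" using Dpos[OF 0 x(2)] Dpos[OF r00] by auto
    have "deriv D x = f (\<phi> x) + g (\<phi> x) * D x powr q - (c - 1) / x * D x"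
      using ode[of x] dom[of x] 0 x r0 p by simp
    moreover have "f (\<phi> x) \<le> f (\<phi> r0)" using monoD[OF f_mono \<phi>mono[OF 0 x(2)]] by simp
    moreover have "g (\<phi> x) * D x powr q \<le> g (\<phi> r0) * D x powr q"
      using monoD[OF g_mono \<phi>mono[OF 0 x(2)]] by (intro mult_right_mono) auto
    moreover have "- ((c - 1) / x * D x) \<le> - ((c - 1) / r0 * D x)"
      using c 0 x Dpos[OF 0 x(2)] by (simp add: mult_right_mono divide_left_mono)
    moreover have "g (\<phi> r0) * D x powr q \<le> g (\<phi> r0) * D r0 powr q + \<bar>g (\<phi> r0)\<bar> * (L * (D r0 - D x))"
    proof -
      have "0 \<le> D r0 powr q - D x powr q"
        using Dmono[OF 0 x(2)] Dpos[OF 0 x(2)] q by (auto intro!: powr_mono2)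
      moreover have "D r0 powr q - D x powr q \<le> L * (D r0 - D x)"
        using Dmono[OF 0 x(2)] Dmono[of ?m x] x r00 by (intro L(2)) auto
      ultimately have "g (\<phi> r0) * (D x powr q - D r0 powr q) \<le> \<bar>g (\<phi> r0)\<bar> * (L * (D r0 - D x))"
        by (smt (verit, best) mult_left_mono mult_minus_left mult_minus_right mult_right_mono abs_ge_minus_self)
      then show ?thesis by (simp add: algebra_simps)
    qed
    ultimately have "deriv D x \<le> f (\<phi> r0) + g (\<phi> r0) * D r0 powr q - (c - 1) / r0 * D r0 + C * (D r0 - D x)"
      unfolding C_def distrib_right mult.assoc[of "\<bar>g (\<phi> r0)\<bar>"] right_diff_distrib[of "(c - 1) / r0"] by linarith
    also have "f (\<phi> r0) + g (\<phi> r0) * D r0 powr q - (c - 1) / r0 * D r0 = deriv D r0"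
      using ode[of r0] dom[of r0] r00 r0 p by simp
    finally show ?thesis using le0 by simp
  qed
  \<comment> \<open>By \<open>le\<close> the function \<open>(D r0 - D x) * exp (C * x)\<close> is
    nondecreasing, and it vanishes at \<open>r0\<close>. Hence it is nonpositive at
    \<open>?m\<close>, contrary to strict monotonicity of \<open>D\<close>.\<close>
  have "(D r0 - D ?m) * exp (C * ?m) \<le> (D r0 - D r0) * exp (C * r0)"
  proof (rule deriv_nonneg_imp_mono[of ?m r0 "\<lambda>x. (D r0 - D x) * exp (C * x)"
        "\<lambda>x. (C * (D r0 - D x) - deriv D x) * exp (C * x)"])
    fix x assume "x \<in> {?m..r0}"
    then have x: "0 < x" "?m \<le> x" "x \<le> r0" using r00 by auto
    show "((\<lambda>x. (D r0 - D x) * exp (C * x)) has_real_derivative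
      (C * (D r0 - D x) - deriv D x) * exp (C * x)) (at x)"
      using D_deriv[of x] dom[of x] x r0 by (auto intro!: derivative_eq_intros simp: algebra_simps)
    show "0 \<le> (C * (D r0 - D x) - deriv D x) * exp (C * x)" using le[OF x(2,3)] by simp
  qed (use r00 in simp)
  then have "D r0 \<le> D ?m" by (simp add: mult_le_0_iff)
  moreover have "D ?m < D r0"
  proof (rule DERIV_pos_imp_increasing_open[of ?m r0 D])
    show "continuous_on {?m..r0} D"
      by (rule continuous_at_imp_continuous_on) (use r0 r00 dom in \<open>auto intro!: D_cont\<close>)
    fix z assume that: "?m < z" "z < r0"
    show "\<exists>d. (D has_real_derivative d) (at z) \<and> d > 0"
      using D_deriv[of z] pos[of z] dom[of z] that r00 r0 by auto
  qed (use r00 in simp)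
  ultimately show False by simp
qed

lemma D_pos: "0 < r \<Longrightarrow> ereal r < R \<Longrightarrow> D r > 0"
  using D2_pos_imp_D_pos[of r] D2_pos dom_le[of r] by auto

lemma ode': "0 < r \<Longrightarrow> ereal r < R \<Longrightarrow>
   deriv D r = f (\<phi> r) + g (\<phi> r) * D r powr q - (c - 1) / r * D r"
  using ode[of r] D_pos[of r] by simp

lemma D_mono: "0 < s \<Longrightarrow> s \<le> r \<Longrightarrow> ereal r < R \<Longrightarrow> D s \<le> D r"
  using dom_le[of r] by (intro deriv_nonneg_imp_mono[of s r D "deriv D"] D_deriv) (auto intro!: less_imp_le D2_pos)

lemma \<phi>_mono: "0 < s \<Longrightarrow> s \<le> r \<Longrightarrow> ereal r < R \<Longrightarrow> \<phi> s \<le> \<phi> r"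
  using dom_le[of r] by (intro deriv_nonneg_imp_mono[of s r \<phi> D] \<phi>_deriv) (auto intro!: less_imp_le D_pos)

lemma \<phi>_gt: assumes "0 < r" "ereal r < R" shows "a < \<phi> r"
proof -
  have "a \<le> \<phi> (r / 2)"
  proof (rule tendsto_upperbound[OF \<phi>_lim_0])
    show "\<forall>\<^sub>F x in at_right 0. \<phi> x \<le> \<phi> (r / 2)"
      unfolding eventually_at_right_field
      by (intro exI[of _ "r / 2"]) (use assms dom_le \<phi>_mono in auto)
  qed simp
  also have "\<phi> (r / 2) < \<phi> r"
  proof (rule DERIV_pos_imp_increasing[of "r / 2" r \<phi>])
    fix x assume "r / 2 \<le> x" "x \<le> r"
    then have "0 < x" "ereal x < R" using assms dom_le[OF assms(2)] by auto
    then show "\<exists>y. (\<phi> has_real_derivative y) (at x) \<and> y > 0"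
      using \<phi>_deriv D_pos by blast
  qed (use assms in simp)
  finally show ?thesis .
qed

lemma \<phi>_minus_le: assumes "0 < r" "ereal r < R" shows "\<phi> r - a \<le> r * D r"
proof -
  have "\<phi> r - D r * r \<le> a - D r * 0"
  proof (rule le_limit_at_right_if_deriv_nonpos[of "\<lambda>x. \<phi> x - D r * x"])
    show "((\<lambda>x. \<phi> x - D r * x) \<longlongrightarrow> a - D r * 0) (at_right 0)"
      by (intro tendsto_intros \<phi>_lim_0)
    fix x assume x: "0 < x" "x \<le> r"
    then have "((\<lambda>x. \<phi> x - D r * x) has_real_derivative D x - D r) (at x)"
      using \<phi>_deriv[of x] dom_le[OF assms(2)] by (auto intro!: derivative_eq_intros)
    then show "\<exists>y. ((\<lambda>x. \<phi> x - D r * x) has_real_derivative y) (at x) \<and> y \<le> 0"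
      using D_mono[OF x assms(2)] by force
  qed (use assms in auto)
  then show ?thesis by (simp add: mult.commute)
qed

end

section \<open>A priori bounds and continuation beyond a finite endpoint\<close>

lemma mono_bounded_tendsto_at_left:
  fixes h :: "real \<Rightarrow> real"
  assumes "s < \<rho>" and mono: "\<And>x y. s < x \<Longrightarrow> x \<le> y \<Longrightarrow> y < \<rho> \<Longrightarrow> h x \<le> h y"
    and bnd: "\<And>x. s < x \<Longrightarrow> x < \<rho> \<Longrightarrow> h x \<le> M"
  obtains l where "(h \<longlongrightarrow> l) (at_left \<rho>)" "\<And>x. s < x \<Longrightarrow> x < \<rho> \<Longrightarrow> h x \<le> l"
proof
  define l where "l = (SUP x\<in>{s<..<\<rho>}. h x)"
  have bdd: "bdd_above (h ` {s<..<\<rho>})" using bnd by (intro bdd_aboveI2[of _ _ M]) auto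
  show le: "h x \<le> l" if "s < x" "x < \<rho>" for x
    unfolding l_def using that by (intro cSUP_upper bdd) auto
  show "(h \<longlongrightarrow> l) (at_left \<rho>)"
  proof (rule increasing_tendsto)
    show "\<forall>\<^sub>F n in at_left \<rho>. h n \<le> l"
      unfolding eventually_at_left_field by (intro exI[of _ s]) (use assms le in auto)
    fix x assume "x < l"
    then obtain y where y: "s < y" "y < \<rho>" "x < h y"
      unfolding l_def using \<open>s < \<rho>\<close> by (subst (asm) less_cSUP_iff) (auto intro: bdd)
    have "x < h n" if "y < n" "n < \<rho>" for n
      using mono[of y n] y that by simp
    then show "\<forall>\<^sub>F n in at_left \<rho>. x < h n"
      unfolding eventually_at_left_field using y by blast
  qed
qed

context radial_solution
begin

text \<open>Since \<open>q \<le> 2\<close>, \<open>D powr q\<close> is at most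
  \<open>1 + D\<^sup>2\<close>, so \<open>deriv D \<le> A + G * D\<^sup>2\<close>. Then
  \<open>ln (A + G * D\<^sup>2)\<close> grows at most at the rate \<open>2 * G * D\<close>, which is
  the derivative of \<open>2 * G * \<phi>\<close>; so a bound on \<open>\<phi>\<close> controls
  \<open>D\<close>.\<close>

lemma D_bounded_if_\<phi>_bounded:
  assumes R: "R = ereal \<rho>" and bnd: "\<And>r. 0 < r \<Longrightarrow> r < \<rho> \<Longrightarrow> \<phi> r \<le> M"
  obtains P where "\<And>r. 0 < r \<Longrightarrow> r < \<rho> \<Longrightarrow> D r \<le> P"
proof -
  have \<rho>: "\<rho> > 0" using R_pos R by simp
  \<comment> \<open>The summand 1 makes \<open>G\<close> positive, so that the final estimate can be
    divided by it.\<close>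
  define G where "G = max (g M) 0 + 1"
  define A where "A = f M + G"
  have G: "G > 0" by (simp add: G_def)
  have A: "A > 0" using G f_pos[of M] by (simp add: A_def)
  have D2: "deriv D r \<le> A + G * (D r)\<^sup>2" if r: "0 < r" "r < \<rho>" for r
  proof -
    have dom: "ereal r < R" using r R by simp
    have Dp: "D r > 0" using D_pos[OF r(1) dom] .
    have "D r powr q \<le> 1 + (D r)\<^sup>2"
    proof (cases "D r \<le> 1")
      case True
      then have "D r powr q \<le> 1 powr q" using Dp q by (intro powr_mono2) auto
      then show ?thesis using zero_le_power2[of "D r"] unfolding powr_one_eq_one by linarith
    next
      case False
      then have "D r powr q \<le> D r powr 2" using q by (intro powr_mono) auto
      then show ?thesis using Dp by simp
    qed
    then have "G * D r powr q \<le> G * (1 + (D r)\<^sup>2)" using G by (intro mult_left_mono) auto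
    moreover have "g (\<phi> r) * D r powr q \<le> G * D r powr q"
      using monoD[OF g_mono bnd[OF r]] by (intro mult_right_mono) (auto simp: G_def)
    moreover have "f (\<phi> r) \<le> f M" using monoD[OF f_mono bnd[OF r]] .
    moreover have "(c - 1) / r * D r \<ge> 0" using c r Dp by simp
    ultimately show ?thesis using ode'[OF r(1) dom] by (simp add: A_def algebra_simps)
  qed
  define N where "N = (\<lambda>r. (A + G * (D r)\<^sup>2) * exp (- 2 * G * \<phi> r))"
  let ?s = "\<rho> / 2"
  have N: "N r \<le> N ?s" if r: "?s \<le> r" "r < \<rho>" for r
  proof (rule DERIV_nonpos_imp_nonincreasing[OF r(1)])
    fix x assume x: "?s \<le> x" "x \<le> r"
    then have x': "0 < x" "x < \<rho>" "ereal x < R" using r \<rho> R by auto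
    have "(N has_real_derivative 2 * G * D x * exp (- 2 * G * \<phi> x) * (deriv D x - (A + G * (D x)\<^sup>2))) (at x)"
      unfolding N_def using D_deriv[of x] \<phi>_deriv[of x] x'
      by (auto intro!: derivative_eq_intros simp: algebra_simps power2_eq_square)
    moreover have "2 * G * D x * exp (- 2 * G * \<phi> x) * (deriv D x - (A + G * (D x)\<^sup>2)) \<le> 0"
      using D2[OF x'(1,2)] D_pos[OF x'(1,3)] G by (intro mult_nonneg_nonpos) auto
    ultimately show "\<exists>y. (N has_real_derivative y) (at x) \<and> y \<le> 0" by blast
  qed
  define K where "K = N ?s * exp (2 * G * M)"
  have N0: "N r > 0" for r unfolding N_def using A G by (intro mult_pos_pos add_pos_nonneg) auto
  have bd: "D r \<le> sqrt (K / G)" if r: "?s \<le> r" "r < \<rho>" for r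
  proof -
    have "G * (D r)\<^sup>2 \<le> N r * exp (2 * G * \<phi> r)"
      using A by (simp add: N_def mult.assoc flip: exp_add)
    also have "\<dots> \<le> K" unfolding K_def
      using N[OF r] N0[of r] G bnd[of r] r \<rho> by (intro mult_mono) auto
    finally have "(D r)\<^sup>2 \<le> K / G" using G by (simp add: field_simps)
    then show ?thesis by (rule real_le_rsqrt)
  qed
  have "D r \<le> sqrt (K / G)" if r: "0 < r" "r < \<rho>" for r
    using bd[of r] bd[of ?s] D_mono[of r ?s] r R by (cases "?s \<le> r") auto
  then show ?thesis by (rule that)
qed

text \<open>Boundedness and monotonicity give limits \<open>b\<close> of \<open>\<phi>\<close> and
  \<open>p > 0\<close> of \<open>D\<close> at \<open>\<rho>\<close>, and a local solution started
  from these values is glued on. Near 0 nothing changes, so the initial conditions carry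
  over.\<close>

lemma extendable_if_bounded:
  assumes R: "R = ereal \<rho>" and bnd: "\<And>r. 0 < r \<Longrightarrow> r < \<rho> \<Longrightarrow> \<phi> r \<le> M"
  shows "\<exists>R' \<psi>. R < R' \<and> cauchy_solution f g c q a \<psi> R' \<and> (\<forall>r. 0 \<le> r \<and> ereal r < R \<longrightarrow> \<psi> r = \<phi> r)"
proof -
  have \<rho>: "\<rho> > 0" using R_pos R by simp
  obtain P where P: "\<And>r. 0 < r \<Longrightarrow> r < \<rho> \<Longrightarrow> D r \<le> P"
    by (rule D_bounded_if_\<phi>_bounded[OF R]) (use bnd in blast)+
  obtain b where b: "(\<phi> \<longlongrightarrow> b) (at_left \<rho>)"
    by (rule mono_bounded_tendsto_at_left[of 0 \<rho> \<phi> M]) (use \<rho> R \<phi>_mono bnd in auto)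
  obtain p where p: "(D \<longlongrightarrow> p) (at_left \<rho>)" and p': "\<And>x. 0 < x \<Longrightarrow> x < \<rho> \<Longrightarrow> D x \<le> p"
    by (rule mono_bounded_tendsto_at_left[of 0 \<rho> D P]) (use \<rho> R D_mono P in auto)
  have p0: "p > 0" using p'[of "\<rho> / 2"] D_pos[of "\<rho> / 2"] \<rho> R by simp
  obtain \<epsilon> u v where e: "\<epsilon> > 0" "u \<rho> = b" "v \<rho> = p"
    and u: "\<And>r. r \<in> {\<rho>..\<rho>+\<epsilon>} \<Longrightarrow> (u has_real_derivative v r) (at r within {\<rho>..\<rho>+\<epsilon>})"
    and v: "\<And>r. r \<in> {\<rho>..\<rho>+\<epsilon>} \<Longrightarrow>
       (v has_real_derivative f (u r) + g (u r) * \<bar>v r\<bar> powr q - (c - 1) / r * v r) (at r within {\<rho>..\<rho>+\<epsilon>})"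
    using radial_local_existence[OF q(1) c f_cont f_mono g_cont g_mono \<rho> p0, where b = b] by metis
  define \<psi> where "\<psi> = (\<lambda>r. if r < \<rho> then \<phi> r else u r)"
  define w where "w = (\<lambda>r. if r < \<rho> then D r else v r)"
  \<comment> \<open>The second derivative that the equation prescribes. Being composed of continuous
    functions, it shows that the glued function is twice continuously differentiable also at
    \<open>\<rho>\<close>.\<close>
  define F where "F = (\<lambda>r. f (\<psi> r) + g (\<psi> r) * \<bar>w r\<bar> powr q - (c - 1) / r * w r)"
  have ev: "\<forall>\<^sub>F r in at_left \<rho>. 0 < r \<and> r < \<rho>"
    unfolding eventually_at_left_field using \<rho> by (intro exI[of _ 0]) auto
  \<comment> \<open>The equation itself supplies the left limit of the second derivative, which
    gluing \<open>w\<close> requires.\<close>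
  have "((\<lambda>r. f (\<phi> r) + g (\<phi> r) * \<bar>D r\<bar> powr q - (c - 1) / r * D r) \<longlongrightarrow>
       f b + g b * \<bar>p\<bar> powr q - (c - 1) / \<rho> * p) (at_left \<rho>)"
    using p0 \<rho> by (intro tendsto_intros f_tendsto g_tendsto b p) auto
  then have D2_lim: "(deriv D \<longlongrightarrow> f b + g b * \<bar>p\<bar> powr q - (c - 1) / \<rho> * p) (at_left \<rho>)"
    by (rule Lim_transform_eventually) (use ev in eventually_elim, simp add: ode R)
  have \<psi>d: "(\<psi> has_real_derivative w r) (at r)" and wd: "(w has_real_derivative F r) (at r)"
    if r: "0 < r" "r < \<rho> + \<epsilon>" for r
  proof -
    consider "r < \<rho>" | "r = \<rho>" | "\<rho> < r" by linarith
    then have "(\<psi> has_real_derivative w r) (at r) \<and> (w has_real_derivative F r) (at r)"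
    proof cases
      case 1
      have 2: "(\<phi> has_real_derivative D r) (at r)" "(D has_real_derivative deriv D r) (at r)"
        using \<phi>_deriv[of r] D_deriv[of r] 1 r R by auto
      have "(\<psi> has_real_derivative D r) (at r)"
        by (rule has_field_derivative_transform_within_open[OF 2(1), of "{..<\<rho>}"]) (use 1 in \<open>auto simp: \<psi>_def\<close>)
      moreover have "(w has_real_derivative deriv D r) (at r)"
        by (rule has_field_derivative_transform_within_open[OF 2(2), of "{..<\<rho>}"]) (use 1 in \<open>auto simp: w_def\<close>)
      moreover have "w r = D r" "\<psi> r = \<phi> r" using 1 by (auto simp: \<psi>_def w_def)
      ultimately show ?thesis using ode[of r] r 1 R by (simp add: F_def)
    next
      case 2
      have "(\<psi> has_real_derivative p) (at \<rho>)"
        unfolding \<psi>_def using \<rho> R e b p u[of \<rho>] \<phi>_deriv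
        by (intro has_real_derivative_glue[where s = 0 and A' = D and \<epsilon> = \<epsilon>]) auto
      moreover have "(w has_real_derivative f b + g b * \<bar>p\<bar> powr q - (c - 1) / \<rho> * p) (at \<rho>)"
        unfolding w_def using \<rho> R e p v[of \<rho>] D_deriv D2_lim
        by (intro has_real_derivative_glue[where s = 0 and A' = "deriv D" and \<epsilon> = \<epsilon>]) auto
      ultimately show ?thesis using 2 e by (simp add: F_def \<psi>_def w_def)
    next
      case 3
      have at: "at r within {\<rho>..\<rho>+\<epsilon>} = at r" using 3 r by (intro at_within_Icc_at) auto
      have 4: "(u has_real_derivative v r) (at r)"
        "(v has_real_derivative f (u r) + g (u r) * \<bar>v r\<bar> powr q - (c - 1) / r * v r) (at r)"
        using u[of r] v[of r] 3 r unfolding at by auto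
      have "(\<psi> has_real_derivative v r) (at r)"
        by (rule has_field_derivative_transform_within_open[OF 4(1), of "{\<rho><..}"]) (use 3 in \<open>auto simp: \<psi>_def\<close>)
      moreover have "(w has_real_derivative f (u r) + g (u r) * \<bar>v r\<bar> powr q - (c - 1) / r * v r) (at r)"
        by (rule has_field_derivative_transform_within_open[OF 4(2), of "{\<rho><..}"]) (use 3 in \<open>auto simp: w_def\<close>)
      moreover have "w r = v r" "\<psi> r = u r" using 3 by (auto simp: \<psi>_def w_def)
      ultimately show ?thesis by (simp add: F_def)
    qed
    then show "(\<psi> has_real_derivative w r) (at r)" "(w has_real_derivative F r) (at r)" by auto
  qed
  have dw: "deriv \<psi> r = w r" if "0 < r" "r < \<rho> + \<epsilon>" for r
    using \<psi>d[OF that] by (rule DERIV_imp_deriv)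
  have dwd: "(deriv \<psi> has_real_derivative F r) (at r)" if "0 < r" "r < \<rho> + \<epsilon>" for r
    by (rule has_field_derivative_transform_within_open[OF wd[OF that], of "{0<..<\<rho>+\<epsilon>}"])
      (use that dw in auto)
  have ddw: "deriv (deriv \<psi>) r = F r" if "0 < r" "r < \<rho> + \<epsilon>" for r
    using dwd[OF that] by (rule DERIV_imp_deriv)
  have \<psi>c: "continuous_on {0<..<\<rho>+\<epsilon>} \<psi>" and wc: "continuous_on {0<..<\<rho>+\<epsilon>} w"
    using \<psi>d wd by (auto intro!: continuous_at_imp_continuous_on DERIV_isCont)
  have Fc: "continuous_on {0<..<\<rho>+\<epsilon>} F"
    unfolding F_def using q
    by (intro continuous_intros continuous_on_powr' wc continuous_on_compose2[OF f_cont \<psi>c] continuous_on_compose2[OF g_cont \<psi>c]) auto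
  have ev0: "\<forall>\<^sub>F r in at_right 0. 0 < r \<and> r < \<rho>"
    unfolding eventually_at_right_field using \<rho> by (intro exI[of _ \<rho>]) auto
  have \<psi>0: "\<psi> 0 = a" "\<phi> 0 = a" using \<rho> sol by (auto simp: \<psi>_def cauchy_solution_def)
  have dom: "{r. 0 < r \<and> ereal r < ereal (\<rho>+\<epsilon>)} = {0<..<\<rho>+\<epsilon>}"
    "{r. 0 \<le> r \<and> ereal r < ereal (\<rho>+\<epsilon>)} = {0..<\<rho>+\<epsilon>}" by auto
  have "(\<psi> \<longlongrightarrow> a) (at_right 0)"
    by (rule Lim_transform_eventually[OF \<phi>_lim_0]) (use ev0 in eventually_elim, simp add: \<psi>_def)
  then have at0: "(\<psi> \<longlongrightarrow> \<psi> 0) (at 0 within {0..<\<rho>+\<epsilon>})"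
    using \<rho> e \<psi>0 at_within_Icc_at_right[of 0 "\<rho>+\<epsilon>"]
    by (intro tendsto_within_subset[where S = "{0..\<rho>+\<epsilon>}" and T = "{0..<\<rho>+\<epsilon>}"]) auto
  have c0: "continuous_on {0..<\<rho>+\<epsilon>} \<psi>"
    unfolding continuous_on_def
  proof
    fix r assume r: "r \<in> {0..<\<rho>+\<epsilon>}"
    show "(\<psi> \<longlongrightarrow> \<psi> r) (at r within {0..<\<rho>+\<epsilon>})"
    proof (cases "r = 0")
      case False
      then have "isCont \<psi> r" using r \<psi>d[of r] by (auto intro: DERIV_isCont)
      then show ?thesis by (auto simp: isCont_def intro: tendsto_within_subset)
    qed (use at0 in simp)
  qed
  have "(\<phi> has_real_derivative 0) (at_right 0)" using sol by (auto simp: cauchy_solution_def)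
  then have "((\<lambda>y. (\<phi> y - \<phi> 0) / (y - 0)) \<longlongrightarrow> 0) (at_right 0)" by (simp add: has_field_derivative_iff)
  then have "((\<lambda>y. (\<psi> y - \<psi> 0) / (y - 0)) \<longlongrightarrow> 0) (at_right 0)"
    by (rule Lim_transform_eventually) (use ev0 in eventually_elim, simp add: \<psi>0, simp add: \<psi>_def)
  then have d0: "(\<psi> has_real_derivative 0) (at_right 0)" by (simp add: has_field_derivative_iff)
  have d1: "(deriv \<psi> \<longlongrightarrow> 0) (at_right 0)"
    by (rule Lim_transform_eventually[OF D_lim_0]) (use ev0 in eventually_elim, use e in \<open>simp add: dw w_def\<close>)
  have D2_eq: "deriv D r = deriv (deriv \<psi>) r" if "0 < r" "r < \<rho>" for r
  proof -
    have "deriv (deriv \<psi>) r = F r" using that e by (intro ddw) auto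
    also have "\<dots> = deriv D r" using that by (simp add: F_def w_def \<psi>_def ode R)
    finally show ?thesis by simp
  qed
  have d2: "(deriv (deriv \<psi>) \<longlongrightarrow> f a / c) (at_right 0)"
    by (rule Lim_transform_eventually[OF D2_lim_0]) (use ev0 in eventually_elim, simp add: D2_eq)
  have "cauchy_solution f g c q a \<psi> (ereal (\<rho> + \<epsilon>))"
    unfolding cauchy_solution_def dom
  proof (intro conjI allI impI)
    show "0 < ereal (\<rho> + \<epsilon>)" using \<rho> e by simp
    fix r assume "0 < r \<and> ereal r < ereal (\<rho> + \<epsilon>)"
    then have r: "0 < r" "r < \<rho> + \<epsilon>" by auto
    show "\<psi> differentiable at r" "deriv \<psi> differentiable at r"
      using \<psi>d[OF r] dwd[OF r] real_differentiable_def by blast+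
    show "deriv (deriv \<psi>) r + (c - 1) / r * deriv \<psi> r = f (\<psi> r) + g (\<psi> r) * \<bar>deriv \<psi> r\<bar> powr q"
      using ddw[OF r] dw[OF r] by (simp add: F_def)
  next
    show "continuous_on {0<..<\<rho>+\<epsilon>} (deriv (deriv \<psi>))"
      using Fc by (rule continuous_on_eq) (simp add: ddw)
  qed (use c0 d0 d1 d2 \<psi>0 in blast)+
  moreover have "R < ereal (\<rho> + \<epsilon>)" using R e by simp
  moreover have "\<forall>r. 0 \<le> r \<and> ereal r < R \<longrightarrow> \<psi> r = \<phi> r" using R by (simp add: \<psi>_def)
  ultimately show ?thesis by blast
qed

end

section \<open>Maximal solutions and their link to divergent integrals\<close>

locale maximal_radial_solution = radial_solution +
  assumes maximal: "maximal_cauchy_solution f g c q a \<phi> R"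
begin

text \<open>For finite \<open>R\<close> a bounded solution could be continued; for
  \<open>R = \<infinity>\<close> the solution lies above its tangent at \<open>r = 1\<close>, whose
  slope \<open>D 1\<close> is positive.\<close>

lemma \<phi>_unbounded: "\<exists>r>0. ereal r < R \<and> M < \<phi> r"
proof (cases R)
  case (real \<rho>)
  show ?thesis
  proof (rule ccontr)
    assume "\<not> ?thesis"
    then have "\<phi> r \<le> M" if "0 < r" "r < \<rho>" for r using that real by force
    from extendable_if_bounded[OF real this] show False
      using maximal unfolding maximal_cauchy_solution_def by blast
  qed
next
  case PInf
  define r where "r = 1 + (\<bar>M - \<phi> 1\<bar> + 1) / D 1"
  have D1: "D 1 > 0" using D_pos[of 1] PInf by simp
  have r: "1 \<le> r" using D1 by (simp add: r_def)
  have "\<phi> 1 - D 1 * 1 \<le> \<phi> r - D 1 * r"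
  proof (rule deriv_nonneg_imp_mono[of 1 r "\<lambda>x. \<phi> x - D 1 * x" "\<lambda>x. D x - D 1"])
    fix x assume "x \<in> {1..r}"
    then show "((\<lambda>x. \<phi> x - D 1 * x) has_real_derivative D x - D 1) (at x)" "0 \<le> D x - D 1"
      using \<phi>_deriv[of x] D_mono[of 1 x] PInf by (auto intro!: derivative_eq_intros)
  qed (use r in simp)
  moreover have "D 1 * r = D 1 + \<bar>M - \<phi> 1\<bar> + 1" using D1 by (simp add: r_def field_simps)
  ultimately have "M < \<phi> r" by simp
  then show ?thesis using r PInf by (intro exI[of _ r]) auto
next
  case MInf
  then show ?thesis using R_pos by simp
qed

lemma \<phi>_unbounded_beyond:
  assumes "0 < r0" "ereal r0 < R"
  shows "\<exists>r\<ge>r0. ereal r < R \<and> M < \<phi> r"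
proof -
  obtain r where r: "r > 0" "ereal r < R" "max M (\<phi> r0) < \<phi> r" using \<phi>_unbounded by blast
  then have "r0 \<le> r" using \<phi>_mono[of r r0] assms by (cases "r0 \<le> r") auto
  then show ?thesis using r by auto
qed

text \<open>Serves to turn upper bounds on \<open>D\<close> into global existence. The condition
  \<open>near_0\<close> moves the divergence from \<open>{0..}\<close> to
  \<open>{\<phi> r0..}\<close>, where the solution gives information.\<close>

lemma global_if_integral_infinite:
  fixes h :: "real \<Rightarrow> real"
  assumes h: "h \<in> borel_measurable borel" "\<And>t. 0 < t \<Longrightarrow> isCont h t" "\<And>t. 0 < t \<Longrightarrow> 0 \<le> h t"
    and near_0: "\<And>T. \<exists>K\<ge>0. \<forall>t. 0 < t \<and> t \<le> T \<longrightarrow> h t \<le> K / sqrt t"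
    and r0: "0 < r0" "ereal r0 < R" "0 < \<phi> r0"
    and le: "\<And>r. r0 \<le> r \<Longrightarrow> ereal r < R \<Longrightarrow> h (\<phi> r) * D r \<le> C"
    and inf: "(\<integral>\<^sup>+t\<in>{0..}. ennreal (h t) \<partial>lborel) = \<infinity>"
  shows "R = \<infinity>"
proof (cases R)
  case (real \<rho>)
  have "(\<integral>\<^sup>+t\<in>{\<phi> r0..}. ennreal (h t) \<partial>lborel) < \<infinity>"
  proof (rule finite_escape_integral_finite[OF h, where \<phi> = \<phi> and ?r0.0 = r0 and R = \<rho> and D = D and C = C])
    show "\<exists>r\<ge>r0. r < \<rho> \<and> M < \<phi> r" for M
      using \<phi>_unbounded_beyond[OF r0(1,2)] real by auto
  qed (use r0 real le \<phi>_deriv D_pos in \<open>auto intro: less_imp_le\<close>)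
  moreover obtain K where "K \<ge> 0" "\<forall>t. 0 < t \<and> t \<le> \<phi> r0 \<longrightarrow> h t \<le> K / sqrt t"
    using near_0 by blast
  then have "(\<integral>\<^sup>+t\<in>{\<phi> r0..}. ennreal (h t) \<partial>lborel) = \<infinity>"
    using nn_integral_tail_infinite[OF _ _ h(1) inf] by blast
  ultimately show ?thesis by simp
qed (use R_pos in auto)

lemma integral_infinite_if_global:
  fixes h :: "real \<Rightarrow> real"
  assumes h: "h \<in> borel_measurable borel" "\<And>t. \<tau> < t \<Longrightarrow> isCont h t" "\<And>t. \<tau> < t \<Longrightarrow> 0 \<le> h t"
    and r0: "0 < r0" "\<tau> < \<phi> r0" "0 \<le> \<phi> r0"
    and ge: "\<And>r. r0 \<le> r \<Longrightarrow> C \<le> h (\<phi> r) * D r" "C > 0"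
    and R: "R = \<infinity>"
  shows "(\<integral>\<^sup>+t\<in>{0..}. ennreal (h t) \<partial>lborel) = \<infinity>"
proof -
  have "(\<integral>\<^sup>+t\<in>{\<phi> r0..}. ennreal (h t) \<partial>lborel) = \<infinity>"
    by (rule global_integral_infinite[OF h, where \<phi> = \<phi> and ?r0.0 = r0 and D = D and C = C])
      (use r0 R ge \<phi>_deriv D_pos in \<open>auto intro: less_imp_le\<close>)
  moreover have "(\<integral>\<^sup>+t\<in>{\<phi> r0..}. ennreal (h t) \<partial>lborel) \<le> (\<integral>\<^sup>+t\<in>{0..}. ennreal (h t) \<partial>lborel)"
    using r0(3) by (intro nn_integral_mono) (auto simp: indicator_def)
  ultimately show ?thesis by (metis infinity_ennreal_def top.extremum_unique)
qed

end

section \<open>The damped case\<close>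

text \<open>The linear equation of \<open>Y\<close> is studied apart from any solution, for a
  general nonnegative antitone weight \<open>\<kappa>\<close>. \<open>K\<close> and \<open>Z\<close>
  are parameters because any choice of primitives yields the same \<open>Y\<close>.\<close>

locale damped_primitive =
  fixes f \<kappa> K Z :: "real \<Rightarrow> real"
  assumes f_cont': "continuous_on UNIV f" and f_mono': "mono f" and f_pos': "\<And>t. f t > 0"
    and \<kappa>_nonneg: "\<And>t. 0 \<le> \<kappa> t" and \<kappa>_antimono: "\<And>s t. s \<le> t \<Longrightarrow> \<kappa> t \<le> \<kappa> s"
    and K_deriv: "\<And>t. (K has_real_derivative \<kappa> t * f t) (at t)"
    and Z_deriv: "\<And>t. (Z has_real_derivative exp (2 * K t) * f t) (at t)"
begin

text \<open>Variation of constants: the solution of \<open>Y' = f - 2 * \<kappa> * f * Y\<close>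
  that vanishes at \<open>b\<close>. Two starting points occur, \<open>a\<close> for the radial
  solution and 0 for the integral in the theorem.\<close>

definition Y :: "real \<Rightarrow> real \<Rightarrow> real" where
  "Y b t = exp (- 2 * K t) * (Z t - Z b)"

lemma K_mono: "s \<le> t \<Longrightarrow> K s \<le> K t"
  by (rule deriv_nonneg_imp_mono[of s t K "\<lambda>t. \<kappa> t * f t"])
    (auto intro!: K_deriv mult_nonneg_nonneg \<kappa>_nonneg less_imp_le[OF f_pos'])

lemma Z_strict_mono: "s < t \<Longrightarrow> Z s < Z t"
  by (rule DERIV_pos_imp_increasing[of s t Z])
    (auto intro!: exI[of _ "exp (2 * K _) * f _"] Z_deriv mult_pos_pos f_pos')

lemma Z_mono: "s \<le> t \<Longrightarrow> Z s \<le> Z t"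
  using Z_strict_mono[of s t] by (cases "s = t") auto

lemma Z_increment:
  assumes "s < t"
  obtains x where "s < x" "x < t" "Z t - Z s = (t - s) * (exp (2 * K x) * f x)"
  using MVT2[OF assms, of Z "\<lambda>t. exp (2 * K t) * f t"] Z_deriv by auto

lemma Y_pos: "b < t \<Longrightarrow> 0 < Y b t"
  using Z_strict_mono by (simp add: Y_def)

lemma Y_nonneg: "b \<le> t \<Longrightarrow> 0 \<le> Y b t"
  using Z_mono by (simp add: Y_def)

lemma Y_self [simp]: "Y b b = 0"
  by (simp add: Y_def)

lemma Y_deriv: "(Y b has_real_derivative f t - 2 * \<kappa> t * f t * Y b t) (at t)"
proof -
  have "((\<lambda>t. exp (- 2 * K t) * (Z t - Z b)) has_real_derivative
    exp (- 2 * K t) * (- 2 * (\<kappa> t * f t)) * (Z t - Z b) + exp (- 2 * K t) * (exp (2 * K t) * f t)) (at t)"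
    by (auto intro!: derivative_eq_intros K_deriv Z_deriv)
  also have "exp (- 2 * K t) * (- 2 * (\<kappa> t * f t)) * (Z t - Z b) + exp (- 2 * K t) * (exp (2 * K t) * f t)
    = f t - 2 * \<kappa> t * f t * Y b t"
    by (simp add: Y_def mult.assoc[symmetric] flip: exp_add)
  finally show ?thesis by (simp add: Y_def[abs_def])
qed

lemma Y_isCont: "isCont (Y b) t"
  using Y_deriv by (rule DERIV_isCont)

text \<open>The derivative \<open>exp (2 * K) * f\<close> of \<open>Z\<close> is nondecreasing, so
  its mean over \<open>{b..t}\<close> is at most its value at \<open>t\<close>.\<close>

lemma Y_le: assumes "b \<le> t" shows "Y b t \<le> (t - b) * f t"
proof (cases "b = t")
  case False
  then have "b < t" using assms by simp
  then obtain x where x: "b < x" "x < t" "Z t - Z b = (t - b) * (exp (2 * K x) * f x)"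
    by (rule Z_increment)
  have "exp (2 * K x) * f x \<le> exp (2 * K t) * f t"
    using K_mono[of x t] monoD[OF f_mono', of x t] x f_pos'[of x] by (intro mult_mono) auto
  then have "Y b t \<le> exp (- 2 * K t) * ((t - b) * (exp (2 * K t) * f t))"
    unfolding Y_def x(3) using assms by (intro mult_left_mono) auto
  also have "\<dots> = (t - b) * f t * (exp (- 2 * K t) * exp (2 * K t))" by simp
  also have "exp (- 2 * K t) * exp (2 * K t) = 1" by (simp flip: exp_add)
  finally show ?thesis by simp
qed simp

text \<open>As \<open>\<kappa> s \<ge> \<kappa> t\<close> for \<open>s \<le> t\<close>, the function
  \<open>exp (2 * K s)\<close> grows at least \<open>2 * \<kappa> t\<close> times as fast as
  \<open>Z\<close>. In other words, \<open>Y\<close> does not cross the level at which the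
  right-hand side of its equation vanishes.\<close>

lemma \<kappa>_Y_le: assumes "b \<le> t" shows "2 * \<kappa> t * Y b t \<le> 1"
proof -
  have "exp (2 * K b) - 2 * \<kappa> t * Z b \<le> exp (2 * K t) - 2 * \<kappa> t * Z t"
  proof (rule deriv_nonneg_imp_mono[OF _ _ assms])
    fix s assume s: "s \<in> {b..t}"
    show "((\<lambda>s. exp (2 * K s) - 2 * \<kappa> t * Z s) has_real_derivative
      2 * exp (2 * K s) * f s * (\<kappa> s - \<kappa> t)) (at s)"
      by (auto intro!: derivative_eq_intros K_deriv Z_deriv simp: algebra_simps)
    show "0 \<le> 2 * exp (2 * K s) * f s * (\<kappa> s - \<kappa> t)"
      using \<kappa>_antimono[of s t] s f_pos'[of s] by (intro mult_nonneg_nonneg) auto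
  qed
  then have "2 * \<kappa> t * (Z t - Z b) \<le> exp (2 * K t)"
    using exp_gt_zero[of "2 * K b"] by (simp only: right_diff_distrib)
  then have "exp (- 2 * K t) * (2 * \<kappa> t * (Z t - Z b)) \<le> exp (- 2 * K t) * exp (2 * K t)"
    by (intro mult_left_mono) auto
  also have "\<dots> = 1" by (simp flip: exp_add)
  also have "exp (- 2 * K t) * (2 * \<kappa> t * (Z t - Z b)) = 2 * \<kappa> t * Y b t"
    by (simp only: Y_def mult_ac)
  finally show ?thesis .
qed

text \<open>Changing the starting point alters \<open>Z t - Z b\<close> by a constant only, and a
  constant is at most a multiple of \<open>Z t - Z b'\<close> once the latter is at least
  \<open>d > 0\<close>.\<close>

lemma Y_comparable:
  assumes "b < t0" "b' < t0"
  obtains C where "C > 0" "\<And>t. t0 \<le> t \<Longrightarrow> Y b t \<le> C * Y b' t"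
proof
  define d where "d = Z t0 - Z b'"
  have d: "d > 0" using Z_strict_mono assms by (simp add: d_def)
  show "1 + \<bar>Z b' - Z b\<bar> / d > 0" using d by (simp add: add_pos_nonneg)
  fix t assume "t0 \<le> t"
  then have t: "d \<le> Z t - Z b'" using Z_mono by (simp add: d_def)
  have "Z t - Z b \<le> (Z t - Z b') + \<bar>Z b' - Z b\<bar> / d * d" using d by simp
  also have "\<dots> \<le> (Z t - Z b') + \<bar>Z b' - Z b\<bar> / d * (Z t - Z b')"
    using t d by (intro add_left_mono mult_left_mono) auto
  finally have "Z t - Z b \<le> (1 + \<bar>Z b' - Z b\<bar> / d) * (Z t - Z b')" by (simp add: algebra_simps)
  then have "exp (- 2 * K t) * (Z t - Z b) \<le> exp (- 2 * K t) * ((1 + \<bar>Z b' - Z b\<bar> / d) * (Z t - Z b'))"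
    by (intro mult_left_mono) auto
  then show "Y b t \<le> (1 + \<bar>Z b' - Z b\<bar> / d) * Y b' t" by (simp add: Y_def mult_ac)
qed

lemma inverse_sqrt_Y_near_0: "\<exists>C\<ge>0. \<forall>t. 0 < t \<and> t \<le> T \<longrightarrow> 1 / sqrt (Y 0 t) \<le> C / sqrt t"
proof -
  \<comment> \<open>From below, \<open>m\<close> bounds the integrand of \<open>Y 0 t\<close> for
    all \<open>t \<le> T\<close>: the exponential weight is least over the full interval
    \<open>{0..T}\<close>, and \<open>f\<close> is least at 0.\<close>
  define m where "m = exp (2 * K 0 - 2 * K T) * f 0"
  have m: "m > 0" using f_pos' by (simp add: m_def)
  have "1 / sqrt (Y 0 t) \<le> (1 / sqrt m) / sqrt t" if t: "0 < t" "t \<le> T" for t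
  proof -
    obtain x where x: "0 < x" "x < t" "Z t - Z 0 = (t - 0) * (exp (2 * K x) * f x)"
      using Z_increment[OF t(1)] by blast
    have "exp (2 * K 0) * f 0 \<le> exp (2 * K x) * f x"
      using K_mono[of 0 x] monoD[OF f_mono', of 0 x] x f_pos'[of 0] by (intro mult_mono) auto
    then have "exp (- 2 * K T) * (t * (exp (2 * K 0) * f 0)) \<le> exp (- 2 * K t) * (t * (exp (2 * K x) * f x))"
      using K_mono[OF t(2)] t f_pos'[of 0] by (intro mult_mono[of "exp (- 2 * K T)"] mult_left_mono) auto
    then have "m * t \<le> Y 0 t"
      unfolding Y_def x(3) by (simp add: m_def exp_diff exp_minus field_simps)
    then have "sqrt m * sqrt t \<le> sqrt (Y 0 t)" by (simp flip: real_sqrt_mult)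
    then have "1 / sqrt (Y 0 t) \<le> 1 / (sqrt m * sqrt t)" using m t by (intro divide_left_mono) (auto intro!: mult_pos_pos Y_pos)
    then show ?thesis by simp
  qed
  then show ?thesis using m by (intro exI[of _ "1 / sqrt m"]) auto
qed

lemma inverse_sqrt_Y_measurable [measurable]: "(\<lambda>t. 1 / sqrt (Y 0 t)) \<in> borel_measurable borel"
proof -
  have "Y 0 \<in> borel_measurable borel"
    by (intro borel_measurable_continuous_onI continuous_at_imp_continuous_on) (simp add: Y_isCont)
  then show ?thesis by measurable
qed

text \<open>The exponential of the inner integral splits into \<open>exp (- 2 * K t)\<close> and
  \<open>exp (2 * K s)\<close>, and the latter times \<open>f s\<close> is the derivative of
  \<open>Z\<close>.\<close>

lemma Y_eq_integral:
  assumes "0 \<le> t"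
  shows "integral {0..t} (\<lambda>s. exp (- 2 * integral {s..t} (\<lambda>\<tau>. \<kappa> \<tau> * f \<tau>)) * f s) = Y 0 t"
proof -
  have K: "integral {s..t} (\<lambda>\<tau>. \<kappa> \<tau> * f \<tau>) = K t - K s" if "s \<le> t" for s
    by (intro integral_unique fundamental_theorem_of_calculus that)
      (auto intro!: has_vector_derivative_at_within[OF K_deriv[unfolded has_real_derivative_iff_has_vector_derivative]])
  have "((\<lambda>s. exp (2 * K s) * f s) has_integral Z t - Z 0) {0..t}"
    by (intro fundamental_theorem_of_calculus assms)
      (auto intro!: has_vector_derivative_at_within[OF Z_deriv[unfolded has_real_derivative_iff_has_vector_derivative]])
  then have "((\<lambda>s. exp (- 2 * K t) * (exp (2 * K s) * f s)) has_integral Y 0 t) {0..t}"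
    unfolding Y_def by (rule has_integral_mult_right)
  then have "((\<lambda>s. exp (- 2 * integral {s..t} (\<lambda>\<tau>. \<kappa> \<tau> * f \<tau>)) * f s) has_integral Y 0 t) {0..t}"
    by (rule has_integral_eq[rotated]) (simp add: K algebra_simps exp_diff exp_minus field_simps)
  then show ?thesis by (rule integral_unique)
qed

text \<open>Only the last piece \<open>{t - \<delta>..t}\<close> of the integral representing
  \<open>Y\<close> is kept. There \<open>K\<close> grows by at most 1/2, so the weight is at least
  \<open>exp (- 1)\<close> and \<open>Y 0 t \<ge> \<delta> * exp (- 1) * f (t / 2)\<close>.\<close>

lemma inverse_Y_le:
  assumes t: "t > 0" and anti: "\<And>s. t / 2 \<le> s \<Longrightarrow> \<kappa> s * f s \<le> \<kappa> (t / 2) * f (t / 2)"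
  shows "1 / Y 0 t \<le> 2 * exp 1 * (1 / (t * f (t / 2)) + \<kappa> (t / 2))"
proof -
  define m where "m = \<kappa> (t / 2) * f (t / 2)"
  \<comment> \<open>Chosen so that \<open>\<delta> \<le> t / 2\<close> and
    \<open>m * \<delta> \<le> 1 / 2\<close>, while \<open>1 / \<delta> = 2 / t + 2 * m\<close>
    produces the two summands of the claim.\<close>
  define \<delta> where "\<delta> = t / (2 * (1 + m * t))"
  have m: "m \<ge> 0" using \<kappa>_nonneg f_pos'[of "t / 2"] by (simp add: m_def)
  have mt: "1 + m * t > 0" using m t by (simp add: add_pos_nonneg)
  have \<delta>: "\<delta> > 0" "\<delta> \<le> t / 2" "m * \<delta> \<le> 1 / 2"
    using m t mt by (auto simp: \<delta>_def field_simps)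
  obtain x where x: "t - \<delta> < x" "x < t" "Z t - Z (t - \<delta>) = (t - (t - \<delta>)) * (exp (2 * K x) * f x)"
    using Z_increment[of "t - \<delta>" t] \<delta> by auto
  have "K t - K (t - \<delta>) \<le> 1 / 2"
  proof -
    obtain y where y: "t - \<delta> < y" "y < t" "K t - K (t - \<delta>) = (t - (t - \<delta>)) * (\<kappa> y * f y)"
      using MVT2[of "t - \<delta>" t K "\<lambda>t. \<kappa> t * f t"] K_deriv \<delta> by auto
    have "K t - K (t - \<delta>) = \<delta> * (\<kappa> y * f y)" using y by simp
    also have "\<dots> \<le> \<delta> * m" using anti[of y] y \<delta> by (intro mult_left_mono) (auto simp: m_def)
    finally show ?thesis using \<delta> by (simp add: mult.commute)
  qed
  then have "exp (- 1) \<le> exp (- 2 * K t) * exp (2 * K x)"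
    using K_mono[of "t - \<delta>" x] x by (simp flip: exp_add)
  moreover have "f (t / 2) \<le> f x" using x \<delta> by (intro monoD[OF f_mono']) auto
  ultimately have "exp (- 1) * f (t / 2) \<le> exp (- 2 * K t) * exp (2 * K x) * f x"
    using f_pos'[of "t / 2"] by (intro mult_mono) auto
  then have "\<delta> * (exp (- 1) * f (t / 2)) \<le> \<delta> * (exp (- 2 * K t) * exp (2 * K x) * f x)"
    using \<delta> by (intro mult_left_mono) auto
  also have "\<dots> = exp (- 2 * K t) * (Z t - Z (t - \<delta>))" by (simp add: x(3))
  also have "\<dots> \<le> Y 0 t"
    unfolding Y_def using Z_mono[of 0 "t - \<delta>"] \<delta> t by (intro mult_left_mono) auto
  finally have "1 / Y 0 t \<le> 1 / (\<delta> * (exp (- 1) * f (t / 2)))"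
    using \<delta> f_pos' by (intro divide_left_mono) (auto intro!: mult_pos_pos Y_pos t)
  also have "\<dots> = 2 * exp 1 * ((1 + m * t) / (t * f (t / 2)))"
    using \<delta> t mt by (simp add: \<delta>_def exp_minus field_simps)
  also have "(1 + m * t) / (t * f (t / 2)) = 1 / (t * f (t / 2)) + \<kappa> (t / 2)"
    using t f_pos'[of "t / 2"] by (simp add: m_def field_simps)
  finally show ?thesis .
qed

end

section \<open>Energy estimates along a solution when g is nonpositive\<close>

locale radial_damped = maximal_radial_solution + damped_primitive f \<kappa> K Z for \<kappa> K Z +
  assumes \<kappa>_eq: "\<And>t. \<kappa> t = (max (- g t) 0 / f t) powr (2 / q)"
    and g_nonpos: "\<And>t. g t \<le> 0"
begin

lemma ode_\<kappa>:
  assumes r: "0 < r" "ereal r < R"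
  shows "deriv D r = f (\<phi> r) * (1 - (\<kappa> (\<phi> r) * (D r)\<^sup>2) powr (q / 2)) - (c - 1) / r * D r"
proof -
  have "(\<kappa> (\<phi> r) * (D r)\<^sup>2) powr (q / 2) = \<kappa> (\<phi> r) powr (q / 2) * (D r powr 2) powr (q / 2)"
    using \<kappa>_nonneg D_pos[OF r] by (simp add: powr_mult)
  also have "\<dots> = - g (\<phi> r) / f (\<phi> r) * D r powr q"
    using g_nonpos[of "\<phi> r"] f_pos[of "\<phi> r"] q by (simp add: \<kappa>_eq powr_powr max_def)
  finally show ?thesis
    using ode'[OF r] f_pos[of "\<phi> r"] by (simp add: field_simps)
qed

text \<open>
  With \<open>w = \<kappa> D\<^sup>2\<close>, positivity of \<open>\<phi>''\<close> means \<open>w < 1\<close>, hence \<open>1 - w\<^bsup>q/2\<^esup> \<le> 1 - w\<close>: this is where the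
  exponent \<open>2 / q\<close> in \<open>\<kappa>\<close> and the restriction \<open>q \<le> 2\<close> come from.
\<close>

lemma D_sq_le: assumes r: "0 < r" "ereal r < R" shows "(D r)\<^sup>2 \<le> 2 * Y a (\<phi> r)"
proof -
  have le: "deriv D x \<le> f (\<phi> x) * (1 - \<kappa> (\<phi> x) * (D x)\<^sup>2)" if x: "0 < x" "ereal x < R" for x
  proof -
    define w where "w = \<kappa> (\<phi> x) * (D x)\<^sup>2"
    have w0: "w \<ge> 0" using \<kappa>_nonneg by (simp add: w_def)
    have "(c - 1) / x * D x \<ge> 0" using c x D_pos[OF x] by simp
    then have 1: "deriv D x \<le> f (\<phi> x) * (1 - w powr (q / 2))"
      using ode_\<kappa>[OF x] by (simp add: w_def)
    with D2_pos[OF x] have "0 < f (\<phi> x) * (1 - w powr (q / 2))" by linarith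
    then have "w powr (q / 2) < 1" using f_pos[of "\<phi> x"] by (simp add: zero_less_mult_iff)
    then have "w < 1" using ge_one_powr_ge_zero[of w "q / 2"] q by fastforce
    then have "w powr 1 \<le> w powr (q / 2)" using w0 q by (intro powr_mono') auto
    then have "f (\<phi> x) * (1 - w powr (q / 2)) \<le> f (\<phi> x) * (1 - w)"
      using w0 f_pos[of "\<phi> x"] by (intro mult_left_mono) auto
    with 1 show ?thesis by (simp add: w_def)
  qed
  \<comment> \<open>The integrating factor \<open>exp (2 * K)\<close> turns the differential
    inequality for \<open>D\<^sup>2 / 2\<close> as a function of \<open>\<phi>\<close> into a
    nonincreasing quantity, whose limit at 0 is \<open>- Z a\<close>.\<close>
  have "exp (2 * K (\<phi> r)) * ((D r)\<^sup>2 / 2) - Z (\<phi> r) \<le> exp (2 * K a) * (0\<^sup>2 / 2) - Z a"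
  proof (rule le_limit_at_right_if_deriv_nonpos[of "\<lambda>r. exp (2 * K (\<phi> r)) * ((D r)\<^sup>2 / 2) - Z (\<phi> r)"])
    show "((\<lambda>r. exp (2 * K (\<phi> r)) * ((D r)\<^sup>2 / 2) - Z (\<phi> r)) \<longlongrightarrow> exp (2 * K a) * (0\<^sup>2 / 2) - Z a) (at_right 0)"
      by (intro tendsto_intros D_lim_0 isCont_tendsto_compose[OF _ \<phi>_lim_0] DERIV_isCont[OF K_deriv] DERIV_isCont[OF Z_deriv]) auto
    fix x assume x: "0 < x" "x \<le> r"
    then have x': "0 < x" "ereal x < R" using dom_le[OF r(2)] by auto
    note [derivative_intros] = DERIV_chain2[OF K_deriv] DERIV_chain2[OF Z_deriv]
    have "((\<lambda>r. exp (2 * K (\<phi> r)) * ((D r)\<^sup>2 / 2) - Z (\<phi> r)) has_real_derivative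
      exp (2 * K (\<phi> x)) * D x * (deriv D x - f (\<phi> x) * (1 - \<kappa> (\<phi> x) * (D x)\<^sup>2))) (at x)"
      using \<phi>_deriv[OF x'] D_deriv[OF x']
      by (auto intro!: derivative_eq_intros simp: algebra_simps power2_eq_square)
    moreover have "exp (2 * K (\<phi> x)) * D x * (deriv D x - f (\<phi> x) * (1 - \<kappa> (\<phi> x) * (D x)\<^sup>2)) \<le> 0"
      using le[OF x'] D_pos[OF x'] by (intro mult_nonneg_nonpos) auto
    ultimately show "\<exists>y. ((\<lambda>r. exp (2 * K (\<phi> r)) * ((D r)\<^sup>2 / 2) - Z (\<phi> r)) has_real_derivative y) (at x) \<and> y \<le> 0"
      by blast
  qed (use r in auto)
  then have "exp (2 * K (\<phi> r)) * (D r)\<^sup>2 \<le> 2 * (Z (\<phi> r) - Z a)" by simp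
  then have "exp (- 2 * K (\<phi> r)) * (exp (2 * K (\<phi> r)) * (D r)\<^sup>2) \<le> exp (- 2 * K (\<phi> r)) * (2 * (Z (\<phi> r) - Z a))"
    by (intro mult_left_mono) auto
  moreover have "exp (- 2 * K (\<phi> r)) * (exp (2 * K (\<phi> r)) * (D r)\<^sup>2) = (D r)\<^sup>2"
    by (simp add: mult.assoc[symmetric] flip: exp_add)
  ultimately have "(D r)\<^sup>2 \<le> exp (- 2 * K (\<phi> r)) * (2 * (Z (\<phi> r) - Z a))" by linarith
  then show ?thesis by (simp only: Y_def mult.left_commute[of _ 2])
qed

text \<open>Wherever \<open>D\<^sup>2 / 2 < C * Y\<close>, absorption and damping are each at most a
  quarter of \<open>f\<close>: the former because \<open>\<kappa>_Y_le\<close> makes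
  \<open>\<kappa> * D\<^sup>2\<close> at most \<open>C\<close>, the latter because
  \<open>Y_le\<close> and convexity give \<open>D \<le> 2 * C * r * f\<close>. Hence
  \<open>deriv D \<ge> f / 2\<close> there, which exceeds \<open>C\<close> times the derivative of
  \<open>Y\<close>.\<close>

lemma D_sq_ge:
  obtains C where "C > 0" "\<And>r. 0 < r \<Longrightarrow> ereal r < R \<Longrightarrow> C * Y a (\<phi> r) \<le> (D r)\<^sup>2"
proof
  \<comment> \<open>The first bound makes \<open>w powr (q / 2)\<close> at most 1/4. The second
    makes \<open>2 * (c - 1) * C\<close> at most 1/4 and, as \<open>c \<ge> 1\<close>, also gives
    \<open>C \<le> 1 / 8\<close>.\<close>
  define C where "C = min ((1 / 4) powr (2 / q)) (1 / (8 * c))"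
  have C: "C > 0" "C \<le> (1 / 4) powr (2 / q)" "C \<le> 1 / (8 * c)" using c by (auto simp: C_def)
  have C2: "C \<le> 1 / 8" using c by (intro order_trans[OF C(3)]) (simp add: field_simps)
  show "2 * C > 0" using C by simp
  fix r assume r: "0 < r" "ereal r < R"
  have "0 \<le> (D r)\<^sup>2 / 2 - C * Y a (\<phi> r)"
  proof (rule nonneg_if_deriv_nonneg_where_neg[of "\<lambda>r. (D r)\<^sup>2 / 2 - C * Y a (\<phi> r)"])
    show "((\<lambda>r. (D r)\<^sup>2 / 2 - C * Y a (\<phi> r)) \<longlongrightarrow> 0\<^sup>2 / 2 - C * Y a a) (at_right 0)"
      by (intro tendsto_intros D_lim_0 isCont_tendsto_compose[OF Y_isCont \<phi>_lim_0]) auto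
    fix x assume x: "0 < x" "x \<le> r"
    then have x': "0 < x" "ereal x < R" using dom_le[OF r(2)] by auto
    define t where "t = \<phi> x"
    have t: "a < t" "t - a \<le> x * D x" using \<phi>_gt[OF x'] \<phi>_minus_le[OF x'] by (auto simp: t_def)
    have Dp: "D x > 0" by (rule D_pos[OF x'])
    note ft = f_pos[of t]
    have d: "((\<lambda>r. (D r)\<^sup>2 / 2 - C * Y a (\<phi> r)) has_real_derivative
      D x * (deriv D x - C * (f t - 2 * \<kappa> t * f t * Y a t))) (at x)"
      unfolding t_def using \<phi>_deriv[OF x'] D_deriv[OF x']
      by (auto intro!: derivative_eq_intros DERIV_chain2[OF Y_deriv] simp: algebra_simps)
    have "0 \<le> deriv D x - C * (f t - 2 * \<kappa> t * f t * Y a t)" if neg: "(D x)\<^sup>2 / 2 - C * Y a (\<phi> x) < 0"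
    proof -
      have lt: "(D x)\<^sup>2 \<le> 2 * C * Y a t" using neg by (simp add: t_def)
      define w where "w = \<kappa> t * (D x)\<^sup>2"
      have "w \<le> \<kappa> t * (2 * C * Y a t)" unfolding w_def using lt \<kappa>_nonneg by (intro mult_left_mono) auto
      also have "\<dots> = C * (2 * \<kappa> t * Y a t)" by simp
      also have "\<dots> \<le> C * 1" using \<kappa>_Y_le[of a t] t C by (intro mult_left_mono) auto
      finally have "w \<le> (1 / 4) powr (2 / q)" using C by simp
      then have "w powr (q / 2) \<le> ((1 / 4) powr (2 / q)) powr (q / 2)"
        using \<kappa>_nonneg q by (intro powr_mono2) (auto simp: w_def)
      also have "\<dots> = 1 / 4" using q by (simp add: powr_powr)
      finally have w: "f t * (w powr (q / 2)) \<le> f t * (1 / 4)" using ft by (intro mult_left_mono) auto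
      have "(D x)\<^sup>2 \<le> 2 * C * ((t - a) * f t)"
        using lt Y_le[of a t] t C by (intro order_trans[OF lt] mult_left_mono) auto
      also have "\<dots> \<le> 2 * C * ((x * D x) * f t)"
        using t C ft by (intro mult_left_mono mult_right_mono) auto
      finally have "D x * D x \<le> (2 * C * x * f t) * D x" by (simp add: power2_eq_square mult_ac)
      then have "D x \<le> 2 * C * x * f t" using Dp mult_le_cancel_right_pos by blast
      then have "(c - 1) / x * D x \<le> (c - 1) / x * (2 * C * x * f t)"
        using c x by (intro mult_left_mono) auto
      also have "\<dots> = 2 * ((c - 1) * C) * f t" using x by simp
      also have "\<dots> \<le> 2 * (1 / 8) * f t"
      proof (intro mult_right_mono mult_left_mono)
        have "(c - 1) * C \<le> c * (1 / (8 * c))" using c C by (intro mult_mono) auto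
        then show "(c - 1) * C \<le> 1 / 8" using c by simp
      qed (use ft in auto)
      finally have "(c - 1) / x * D x \<le> 2 * (1 / 8) * f t" .
      moreover have "deriv D x = f t - f t * (w powr (q / 2)) - (c - 1) / x * D x"
        using ode_\<kappa>[OF x'] by (simp add: w_def t_def right_diff_distrib)
      ultimately have "deriv D x \<ge> f t / 2" using w by linarith
      moreover have "C * (f t - 2 * \<kappa> t * f t * Y a t) \<le> (1 / 8) * f t"
      proof (rule mult_mono)
        show "f t - 2 * \<kappa> t * f t * Y a t \<le> f t"
          using \<kappa>_nonneg[of t] ft Y_nonneg[of a t] t by simp
        show "0 \<le> f t - 2 * \<kappa> t * f t * Y a t"
          using mult_left_mono[OF \<kappa>_Y_le[of a t], of "f t"] t ft by (simp add: mult_ac)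
      qed (use C2 in auto)
      ultimately show ?thesis using ft by linarith
    qed
    then show "\<exists>y. ((\<lambda>r. (D r)\<^sup>2 / 2 - C * Y a (\<phi> r)) has_real_derivative y) (at x)
        \<and> ((D x)\<^sup>2 / 2 - C * Y a (\<phi> x) < 0 \<longrightarrow> 0 \<le> y)"
      using d Dp by (intro exI[of _ "D x * (deriv D x - C * (f t - 2 * \<kappa> t * f t * Y a t))"]) auto
  qed (use r in auto)
  then show "2 * C * Y a (\<phi> r) \<le> (D r)\<^sup>2" by simp
qed

lemma global_iff_damped:
  "R = \<infinity> \<longleftrightarrow> (\<integral>\<^sup>+t\<in>{0..}. ennreal (1 / sqrt (Y 0 t)) \<partial>lborel) = \<infinity>"
proof -
  \<comment> \<open>Beyond both starting points \<open>a\<close> and 0, so that \<open>Y a\<close>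
    and \<open>Y 0\<close> are positive and bounded by multiples of each other.\<close>
  define t0 where "t0 = max a 0 + 1"
  obtain r0 where r0: "r0 > 0" "ereal r0 < R" "t0 < \<phi> r0" using \<phi>_unbounded by blast
  have t0: "a < t0" "0 < t0" by (auto simp: t0_def)
  have beyond: "t0 \<le> \<phi> r" "0 < r" if "r0 \<le> r" "ereal r < R" for r
    using \<phi>_mono[of r0 r] r0 that by auto
  have cont: "isCont (\<lambda>t. 1 / sqrt (Y 0 t)) t" if "0 < t" for t
    using that Y_pos[of 0 t] by (auto intro!: continuous_intros Y_isCont)
  have nn: "0 \<le> 1 / sqrt (Y 0 t)" if "0 < t" for t
    using Y_nonneg[of 0 t] that by simp
  obtain C1 where C1: "C1 > 0" "\<And>t. t0 \<le> t \<Longrightarrow> Y a t \<le> C1 * Y 0 t"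
    using Y_comparable[OF t0] by blast
  obtain C2 where C2: "C2 > 0" "\<And>t. t0 \<le> t \<Longrightarrow> Y 0 t \<le> C2 * Y a t"
    using Y_comparable[OF t0(2,1)] by blast
  obtain C where C: "C > 0" "\<And>r. 0 < r \<Longrightarrow> ereal r < R \<Longrightarrow> C * Y a (\<phi> r) \<le> (D r)\<^sup>2"
    using D_sq_ge by metis
  have Ypos: "Y 0 (\<phi> r) > 0" if "r0 \<le> r" "ereal r < R" for r
    using beyond[OF that] t0 by (intro Y_pos) auto
  show ?thesis
  proof
    assume R: "R = \<infinity>"
    show "(\<integral>\<^sup>+t\<in>{0..}. ennreal (1 / sqrt (Y 0 t)) \<partial>lborel) = \<infinity>"
    proof (rule integral_infinite_if_global[OF inverse_sqrt_Y_measurable cont nn r0(1) _ _ _ _ R])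
      fix r assume r: "r0 \<le> r"
      have dom: "ereal r < R" using R by simp
      have "C / C2 * Y 0 (\<phi> r) \<le> C * Y a (\<phi> r)"
        using C2(2)[OF beyond(1)[OF r dom]] C2(1) C(1) by (simp add: field_simps)
      also have "\<dots> \<le> (D r)\<^sup>2" using C(2) beyond[OF r dom] dom by blast
      finally have "sqrt (C / C2 * Y 0 (\<phi> r)) \<le> D r"
        using D_pos[of r] beyond[OF r dom] dom by (intro real_le_lsqrt) auto
      then have "sqrt (C / C2) * sqrt (Y 0 (\<phi> r)) \<le> D r"
        by (simp only: real_sqrt_mult)
      then show "sqrt (C / C2) \<le> 1 / sqrt (Y 0 (\<phi> r)) * D r"
        using Ypos[OF r dom] by (simp add: pos_le_divide_eq)
    qed (use C C2 r0 t0 in auto)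
  next
    assume inf: "(\<integral>\<^sup>+t\<in>{0..}. ennreal (1 / sqrt (Y 0 t)) \<partial>lborel) = \<infinity>"
    show "R = \<infinity>"
    proof (rule global_if_integral_infinite[OF inverse_sqrt_Y_measurable cont nn inverse_sqrt_Y_near_0 r0(1,2) _ _ inf])
      fix r assume r: "r0 \<le> r" "ereal r < R"
      have "(D r)\<^sup>2 \<le> 2 * Y a (\<phi> r)" using D_sq_le beyond[OF r] r by blast
      also have "\<dots> \<le> 2 * C1 * Y 0 (\<phi> r)" using C1(2)[OF beyond(1)[OF r]] by simp
      finally have "D r \<le> sqrt (2 * C1 * Y 0 (\<phi> r))" by (rule real_le_rsqrt)
      then show "1 / sqrt (Y 0 (\<phi> r)) * D r \<le> sqrt (2 * C1)"
        using Ypos[OF r] by (simp add: real_sqrt_mult field_simps)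
    qed (use r0 t0 in auto)
  qed
qed

end

section \<open>The forced case\<close>

context maximal_radial_solution
begin

text \<open>Without damping, \<open>deriv D \<ge> v * D powr m\<close> would make
  \<open>D powr (2 - m)\<close> grow at least \<open>2 - m\<close> times as fast as
  \<open>V \<circ> \<phi>\<close>. With damping, growth has to be shown only where the claim fails,
  and there convexity makes the damping at most half of \<open>f + g * D powr q\<close>. The
  instances are \<open>m = 0\<close> with \<open>v = f\<close>, \<open>m = q\<close> with
  \<open>v = g\<close>, and some \<open>m > 1\<close> with constant \<open>v\<close>.\<close>

lemma D_powr_ge:
  fixes v V :: "real \<Rightarrow> real"
  assumes m: "0 \<le> m" "m < 2" and r0: "0 < r0" "ereal r0 < R"
    and V: "\<And>t. \<phi> r0 \<le> t \<Longrightarrow> (V has_real_derivative v t) (at t)"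
    and v: "\<And>s t. \<phi> r0 \<le> s \<Longrightarrow> s \<le> t \<Longrightarrow> v s \<le> v t" "0 < v (\<phi> r0)"
    and le: "\<And>r. r0 \<le> r \<Longrightarrow> ereal r < R \<Longrightarrow> v (\<phi> r) * D r powr m \<le> f (\<phi> r) + g (\<phi> r) * D r powr q"
  obtains C where "C > 0" "\<And>r. r0 < r \<Longrightarrow> ereal r < R \<Longrightarrow> C * (V (\<phi> r) - V (\<phi> r0)) \<le> D r powr (2 - m)"
proof
  \<comment> \<open>The bound \<open>1 / (2 * c)\<close> makes the damping at most half of the
    right-hand side; \<open>(2 - m) / 2\<close> is the growth factor left after losing this
    half.\<close>
  define C where "C = min (1 / (2 * c)) ((2 - m) / 2)"
  have C: "C > 0" "C \<le> 1 / (2 * c)" "C \<le> (2 - m) / 2"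
  proof -
    show "C > 0" using c m by (simp add: C_def)
  qed (simp_all only: C_def min.cobounded1 min.cobounded2)
  then show "C > 0" by simp
  fix r assume r: "r0 < r" "ereal r < R"
  define u where "u = (\<lambda>r. D r powr (2 - m) - C * (V (\<phi> r) - V (\<phi> r0)))"
  have d: "(u has_real_derivative D x * ((2 - m) * D x powr (- m) * deriv D x - C * v (\<phi> x))) (at x)"
    if x: "r0 \<le> x" "ereal x < R" for x
  proof -
    have x0: "0 < x" using x r0 by simp
    have Dp: "D x > 0" using D_pos x0 x by simp
    have "(u has_real_derivative (2 - m) * D x powr (2 - m - 1) * deriv D x - C * (v (\<phi> x) * D x)) (at x)"
      unfolding u_def using D_deriv[OF x0 x(2)] \<phi>_deriv[OF x0 x(2)] \<phi>_mono[OF r0(1) x] Dp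
      by (auto intro!: derivative_eq_intros DERIV_chain2[OF V])
    moreover have "D x powr (2 - m - 1) = D x * D x powr (- m)"
      using Dp powr_add[of "D x" 1 "- m"] by simp
    ultimately show ?thesis by (simp add: algebra_simps)
  qed
  have "0 \<le> u r"
  proof (rule nonneg_if_deriv_nonneg_where_neg[OF _ _ r(1)])
    have "isCont u r0" using d[of r0] r0 DERIV_isCont by blast
    then show "(u \<longlongrightarrow> u r0) (at_right r0)"
      by (auto simp: isCont_def intro: filterlim_mono at_le)
    show "0 \<le> u r0" by (simp add: u_def)
    fix x assume "r0 < x" "x \<le> r"
    then have x: "r0 \<le> x" "ereal x < R" "0 < x" using dom_le[OF r(2)] r0 by auto
    define t where "t = \<phi> x"
    have Dp: "D x > 0" using D_pos x by simp
    have t: "\<phi> r0 \<le> t" unfolding t_def using \<phi>_mono r0 x by simp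
    have vt: "0 < v t" using v(1)[of "\<phi> r0" t] v(2) t by simp
    define H where "H = f t + g t * D x powr q"
    have vH: "v t * D x powr m \<le> H" using le[OF x(1,2)] by (simp add: t_def H_def)
    have "0 \<le> (2 - m) * D x powr (- m) * deriv D x - C * v t" if "u x < 0"
    proof -
      \<comment> \<open>\<open>V\<close> is convex on this interval, so its increment is at most the
        final slope times the length.\<close>
      have "V t - V (\<phi> r0) \<le> v t * (t - \<phi> r0)"
      proof -
        have "V t - v t * t \<le> V (\<phi> r0) - v t * \<phi> r0"
        proof (rule DERIV_nonpos_imp_nonincreasing[OF t])
          fix s assume s: "\<phi> r0 \<le> s" "s \<le> t"
          have "((\<lambda>s. V s - v t * s) has_real_derivative v s - v t) (at s)"
            using V[OF s(1)] by (auto intro!: derivative_eq_intros)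
          then show "\<exists>y. ((\<lambda>s. V s - v t * s) has_real_derivative y) (at s) \<and> y \<le> 0"
            using v(1)[OF s] by force
        qed
        then show ?thesis by (simp add: algebra_simps)
      qed
      also have "\<dots> \<le> v t * (x * D x)"
        using \<phi>_minus_le[OF x(3,2)] \<phi>_gt[OF r0] vt by (intro mult_left_mono) (auto simp: t_def)
      finally have "C * (V t - V (\<phi> r0)) \<le> C * (v t * (x * D x))" using C by (intro mult_left_mono) auto
      with that have "D x powr (2 - m) \<le> C * (v t * (x * D x))" by (simp add: u_def t_def)
      \<comment> \<open>The factor turns the left side into \<open>D x / x\<close>, which is the
        damping up to \<open>c - 1\<close>, and the right side into
        \<open>C * (v t * D x powr m)\<close>, which \<open>le\<close> controls.\<close>
      then have "D x powr (2 - m) * (D x powr m / (x * D x)) \<le> C * (v t * (x * D x)) * (D x powr m / (x * D x))"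
        using x Dp by (intro mult_right_mono) auto
      also have "\<dots> = C * (v t * D x powr m)" using x Dp by simp
      also have "\<dots> \<le> C * H" using vH C by (intro mult_left_mono) auto
      also have "D x powr (2 - m) * (D x powr m / (x * D x)) = D x / x"
        using Dp x by (simp add: powr_add[symmetric] power2_eq_square field_simps)
      finally have Dx: "D x / x \<le> C * H" .
      have H0: "0 \<le> H" using vH vt by (smt (verit) mult_nonneg_nonneg powr_ge_zero)
      have "(c - 1) / x * D x = (c - 1) * (D x / x)" by simp
      also have "\<dots> \<le> (c - 1) * (C * H)" using Dx c by (intro mult_left_mono) auto
      also have "\<dots> \<le> (c * C) * H" using C c H0 by (simp add: algebra_simps)
      also have "\<dots> \<le> (1 / 2) * H"
        using C c H0 by (intro mult_right_mono) (auto simp: field_simps)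
      finally have "H / 2 \<le> deriv D x"
        using ode'[OF x(3,2)] by (simp add: H_def t_def)
      then have "v t * D x powr m / 2 \<le> deriv D x" using vH by linarith
      then have "(2 - m) * D x powr (- m) * (v t * D x powr m / 2) \<le> (2 - m) * D x powr (- m) * deriv D x"
        using m by (intro mult_left_mono) auto
      also have "(2 - m) * D x powr (- m) * (v t * D x powr m / 2) = (2 - m) / 2 * v t"
        using Dp by (simp add: powr_minus field_simps)
      finally have "(2 - m) / 2 * v t \<le> (2 - m) * D x powr (- m) * deriv D x" .
      moreover have "C * v t \<le> (2 - m) / 2 * v t" using C vt by (intro mult_right_mono) auto
      ultimately show ?thesis by linarith
    qed
    then show "\<exists>y. (u has_real_derivative y) (at x) \<and> (u x < 0 \<longrightarrow> 0 \<le> y)"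
      using d[OF x(1,2)] Dp unfolding t_def by (meson less_imp_le mult_nonneg_nonneg)
  qed
  then show "C * (V (\<phi> r) - V (\<phi> r0)) \<le> D r powr (2 - m)" by (simp add: u_def)
qed

text \<open>Makes the bound by \<open>V\<close> explicit: convexity gives
  \<open>V t - V (t / 2) \<ge> t / 2 * v (t / 2)\<close>, at the price of the halved
  argument.\<close>

lemma D_ge_half:
  fixes v :: "real \<Rightarrow> real"
  assumes m: "0 \<le> m" "m < 2" and r0: "0 < r0" "ereal r0 < R" "0 \<le> \<phi> r0"
    and v: "continuous_on UNIV v" "mono v" "0 < v (\<phi> r0)"
    and le: "\<And>r. r0 \<le> r \<Longrightarrow> ereal r < R \<Longrightarrow> v (\<phi> r) * D r powr m \<le> f (\<phi> r) + g (\<phi> r) * D r powr q"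
  obtains C where "C > 0" "\<And>r. r0 < r \<Longrightarrow> ereal r < R \<Longrightarrow> 2 * \<phi> r0 \<le> \<phi> r \<Longrightarrow>
    C * (\<phi> r / 2 * v (\<phi> r / 2)) powr (1 / (2 - m)) \<le> D r"
proof -
  obtain V where V: "\<And>t. (V has_real_derivative v t) (at t)"
    using continuous_antiderivative[of "-\<infinity>" v] v(1) by (auto simp: continuous_on_eq_continuous_at)
  have vmono: "v s \<le> v t" if "s \<le> t" for s t using v(2) that by (rule monoD)
  obtain C where C: "C > 0" "\<And>r. r0 < r \<Longrightarrow> ereal r < R \<Longrightarrow> C * (V (\<phi> r) - V (\<phi> r0)) \<le> D r powr (2 - m)"
    using D_powr_ge[OF m r0(1,2) V vmono v(3) le] by metis
  show ?thesis
  proof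
    show "C powr (1 / (2 - m)) > 0" using C by simp
    fix r assume r: "r0 < r" "ereal r < R" "2 * \<phi> r0 \<le> \<phi> r"
    define t where "t = \<phi> r"
    have t: "\<phi> r0 \<le> t / 2" "0 \<le> t / 2" using r r0 by (auto simp: t_def)
    have vpos: "0 < v s" if "\<phi> r0 \<le> s" for s using vmono[OF that] v(3) by simp
    have "V (\<phi> r0) \<le> V (t / 2)"
      by (rule deriv_nonneg_imp_mono[of "\<phi> r0" "t / 2" V v]) (use t V vpos in \<open>auto intro: less_imp_le\<close>)
    moreover have "V (t / 2) - v (t / 2) * (t / 2) \<le> V t - v (t / 2) * t"
    proof (rule deriv_nonneg_imp_mono[of "t / 2" t "\<lambda>s. V s - v (t / 2) * s" "\<lambda>s. v s - v (t / 2)"])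
      fix s assume "s \<in> {t / 2..t}"
      then show "((\<lambda>s. V s - v (t / 2) * s) has_real_derivative v s - v (t / 2)) (at s)" "0 \<le> v s - v (t / 2)"
        using V[of s] vmono[of "t / 2" s] by (auto intro!: derivative_eq_intros)
    qed (use t in simp)
    ultimately have "t / 2 * v (t / 2) \<le> V t - V (\<phi> r0)" by (simp add: algebra_simps)
    then have "C * (t / 2 * v (t / 2)) \<le> C * (V t - V (\<phi> r0))" using C by (intro mult_left_mono) auto
    also have "\<dots> \<le> D r powr (2 - m)" using C(2)[OF r(1,2)] by (simp add: t_def)
    finally have "(C * (t / 2 * v (t / 2))) powr (1 / (2 - m)) \<le> (D r powr (2 - m)) powr (1 / (2 - m))"
      using C t vpos[OF t(1)] m by (intro powr_mono2) auto
    also have "\<dots> = D r" using m D_pos[of r] r r0 by (simp add: powr_powr)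
    also have "(C * (t / 2 * v (t / 2))) powr (1 / (2 - m)) = C powr (1 / (2 - m)) * (t / 2 * v (t / 2)) powr (1 / (2 - m))"
      by (rule powr_mult)
    finally show "C powr (1 / (2 - m)) * (\<phi> r / 2 * v (\<phi> r / 2)) powr (1 / (2 - m)) \<le> D r"
      by (simp only: t_def)
  qed
qed

section \<open>Necessity of q at most 1 and comparison of the derivative with
  \<open>P\<close>\<close>

lemma obtain_start:
  assumes "g T > 0"
  obtains r0 where "0 < r0" "ereal r0 < R" "1 < \<phi> r0" "g (\<phi> r0) > 0"
proof -
  obtain r0 where r0: "r0 > 0" "ereal r0 < R" "max 1 T < \<phi> r0" using \<phi>_unbounded by blast
  then have "g T \<le> g (\<phi> r0)" by (intro monoD[OF g_mono]) auto
  then show ?thesis using that[of r0] r0 assms by simp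
qed

text \<open>For \<open>q > 1\<close> the term \<open>g * D powr q\<close> alone forces
  \<open>D\<close> above a multiple of \<open>\<phi> powr \<beta>\<close> with
  \<open>\<beta> > 1\<close>. Since \<open>t powr (- \<beta>)\<close> is integrable at infinity,
  this excludes \<open>R = \<infinity>\<close>.\<close>

lemma exponent_le_1_if_global:
  assumes T: "g T > 0" and R: "R = \<infinity>"
  shows "q \<le> 1"
proof (rule ccontr)
  assume "\<not> q \<le> 1"
  then have q1: "q > 1" by simp
  obtain r0 where r0: "0 < r0" "ereal r0 < R" "1 < \<phi> r0" "g (\<phi> r0) > 0"
    using T by (rule obtain_start)
  \<comment> \<open>any exponent in \<open>(1, q]\<close> below \<open>2\<close> would do; this also covers \<open>q = 2\<close>\<close>
  define m where "m = (1 + q) / 2"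
  have m: "0 \<le> m" "m < 2" "m \<le> q" "1 < m" using q1 q by (auto simp: m_def)
  \<comment> \<open>As \<open>D\<close> is nondecreasing, the surplus power
    \<open>D powr (q - m)\<close> is at least its value at \<open>r0\<close> and goes into the
    constant.\<close>
  define v0 where "v0 = g (\<phi> r0) * D r0 powr (q - m)"
  have D0: "D r0 > 0" using D_pos r0 by simp
  have v0: "v0 > 0" using r0 D0 by (simp add: v0_def)
  have le: "v0 * D r powr m \<le> f (\<phi> r) + g (\<phi> r) * D r powr q" if r: "r0 \<le> r" for r
  proof -
    have Dr: "D r0 \<le> D r" "0 < D r" using D_mono[of r0 r] D_pos[of r] r r0 R by auto
    have "g (\<phi> r0) \<le> g (\<phi> r)" using \<phi>_mono[of r0 r] r r0 R by (intro monoD[OF g_mono]) auto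
    moreover have "D r0 powr (q - m) \<le> D r powr (q - m)" using Dr m D0 by (intro powr_mono2) auto
    ultimately have "v0 \<le> g (\<phi> r) * D r powr (q - m)"
      unfolding v0_def using r0 by (intro mult_mono) auto
    then have "v0 * D r powr m \<le> g (\<phi> r) * D r powr (q - m) * D r powr m" by (intro mult_right_mono) auto
    also have "\<dots> = g (\<phi> r) * D r powr q" using Dr by (simp add: mult.assoc flip: powr_add)
    finally show ?thesis using f_pos[of "\<phi> r"] by simp
  qed
  obtain C where C: "C > 0" "\<And>r. r0 < r \<Longrightarrow> ereal r < R \<Longrightarrow> 2 * \<phi> r0 \<le> \<phi> r \<Longrightarrow>
      C * (\<phi> r / 2 * v0) powr (1 / (2 - m)) \<le> D r"
    by (rule D_ge_half[OF m(1,2) r0(1,2), of "\<lambda>_. v0"]) (use r0 v0 le in \<open>auto intro: monoI\<close>)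
  define \<beta> where "\<beta> = 1 / (2 - m)"
  have \<beta>: "\<beta> > 1" using m by (simp add: \<beta>_def)
  obtain r1 where r1: "r1 > 0" "2 * \<phi> r0 < \<phi> r1" using \<phi>_unbounded by blast
  define h where "h = (\<lambda>t::real. t powr (- \<beta>))"
  have h: "h \<in> borel_measurable borel" unfolding h_def by measurable
  have hc: "isCont h t" if "0 < t" for t using that by (auto simp: h_def intro!: continuous_intros)
  have "(\<integral>\<^sup>+t\<in>{\<phi> r1..}. ennreal (h t) \<partial>lborel) = \<infinity>"
  proof (rule global_integral_infinite[OF h hc, where \<phi> = \<phi> and ?r0.0 = r1 and D = D and C = "C * (v0 / 2) powr \<beta>"])
    fix r assume r: "r1 \<le> r"
    have mono: "\<phi> r1 \<le> \<phi> r" using \<phi>_mono r1 r R by simp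
    have "r0 < r" using \<phi>_mono[of r1 r0] r1 r0 r R by (cases "r1 \<le> r0") auto
    then have "C * (\<phi> r / 2 * v0) powr \<beta> \<le> D r" using C(2)[of r] R mono r1 by (simp add: \<beta>_def)
    then have "\<phi> r powr (- \<beta>) * (C * (\<phi> r / 2 * v0) powr \<beta>) \<le> \<phi> r powr (- \<beta>) * D r"
      by (intro mult_left_mono) auto
    also have "\<phi> r powr (- \<beta>) * (C * (\<phi> r / 2 * v0) powr \<beta>) = C * (v0 / 2) powr \<beta>"
    proof -
      have "(\<phi> r / 2 * v0) powr \<beta> = \<phi> r powr \<beta> * (v0 / 2) powr \<beta>"
        using mono r1 r0 v0 powr_mult[of "\<phi> r" "v0 / 2" \<beta>] by simp
      then show ?thesis using mono r1 r0 by (simp add: powr_minus)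
    qed
    finally show "C * (v0 / 2) powr \<beta> \<le> h (\<phi> r) * D r" by (simp add: h_def)
  qed (use r1 r0 C v0 R \<phi>_deriv D_pos in \<open>auto simp: h_def intro: less_imp_le\<close>)
  moreover have "(\<integral>\<^sup>+t\<in>{\<phi> r1..}. ennreal (h t) \<partial>lborel) < \<infinity>"
  proof (rule nn_integral_atLeast_finite[OF h, where I = "\<lambda>t. - (t powr (1 - \<beta>) / (\<beta> - 1))" and M = 0])
    fix x assume x: "\<phi> r1 \<le> x"
    then have "((\<lambda>t. t powr (1 - \<beta>)) has_real_derivative (1 - \<beta>) * x powr (1 - \<beta> - 1)) (at x)"
      using r1 r0 by (auto intro!: derivative_eq_intros)
    from DERIV_minus[OF DERIV_cdivide[OF this, of "\<beta> - 1"]]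
    have "((\<lambda>t. - (t powr (1 - \<beta>) / (\<beta> - 1))) has_real_derivative - ((1 - \<beta>) * x powr - \<beta> / (\<beta> - 1))) (at x)"
      by simp
    moreover have "- ((1 - \<beta>) * x powr - \<beta> / (\<beta> - 1)) = h x"
      unfolding h_def minus_divide_left minus_mult_left minus_diff_eq using \<beta> by simp
    ultimately show "((\<lambda>t. - (t powr (1 - \<beta>) / (\<beta> - 1))) has_real_derivative h x) (at x)"
      by simp
    show "- (x powr (1 - \<beta>) / (\<beta> - 1)) \<le> 0" using \<beta> by simp
  qed (simp add: h_def)
  ultimately show False by simp
qed

text \<open>For positive \<open>g\<close> and \<open>q < 2\<close> this is, up to constants, the
  solution \<open>D\<close> of the balance \<open>D\<^sup>2 = t * f + t * g * D powr q\<close>. At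
  \<open>q = 2\<close> the exponent \<open>1 / (2 - q)\<close> is \<open>1 / 0 = 0\<close>;
  continuity is claimed for \<open>q < 2\<close>.\<close>

abbreviation P :: "real \<Rightarrow> real" where
  "P t \<equiv> (t * f t) powr (1 / 2) + (t * max (g t) 0) powr (1 / (2 - q))"

lemma P_pos: "0 < t \<Longrightarrow> 0 < P t"
  using f_pos[of t] by (intro add_pos_nonneg) auto

lemma inverse_P_measurable: "(\<lambda>t. 1 / P t) \<in> borel_measurable borel"
proof -
  have [measurable]: "f \<in> borel_measurable borel" "g \<in> borel_measurable borel"
    using f_cont g_cont by (auto intro: borel_measurable_continuous_onI)
  show ?thesis by measurable
qed

lemma P_isCont: assumes "q < 2" "0 < t" shows "isCont P t"
proof -
  have fg: "isCont f t" "isCont g t" using f_cont g_cont by (auto simp: continuous_on_eq_continuous_at)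
  have "((\<lambda>t. (t * max (g t) 0) powr (1 / (2 - q))) \<longlongrightarrow> (t * max (g t) 0) powr (1 / (2 - q))) (at t)"
  \<comment> \<open>The base vanishes wherever \<open>g\<close> is nonpositive; the rule admits
    this, since the exponent is positive and the base is nonnegative near \<open>t\<close>.\<close>
  proof (rule tendsto_powr2)
    show "((\<lambda>t. t * max (g t) 0) \<longlongrightarrow> t * max (g t) 0) (at t)"
      using fg unfolding isCont_def by (intro tendsto_intros) auto
    have "\<forall>\<^sub>F x in at t. 0 < x" using order_tendstoD(1)[OF tendsto_ident_at assms(2)] .
    then show "\<forall>\<^sub>F x in at t. 0 \<le> x * max (g x) 0" by eventually_elim simp
  qed (use assms in auto)
  moreover have "((\<lambda>t. (t * f t) powr (1 / 2)) \<longlongrightarrow> (t * f t) powr (1 / 2)) (at t)"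
    using fg assms f_pos[of t] unfolding isCont_def by (intro tendsto_intros) auto
  ultimately show ?thesis unfolding isCont_def by (intro tendsto_add)
qed

lemma inverse_P_isCont: assumes "q < 2" "0 < t" shows "isCont (\<lambda>t. 1 / P t) t"
  using P_pos[OF assms(2)] by (intro isCont_divide[OF continuous_const P_isCont[OF assms]]) simp

lemma inverse_P_near_0: "\<exists>K\<ge>0. \<forall>t. 0 < t \<and> t \<le> T \<longrightarrow> 1 / P t \<le> K / sqrt t"
proof (intro exI conjI allI impI)
  show "0 \<le> 1 / sqrt (f 0)" using f_pos[of 0] by simp
  fix t assume t: "0 < t \<and> t \<le> T"
  have "sqrt t * sqrt (f 0) \<le> sqrt t * sqrt (f t)"
    using t monoD[OF f_mono, of 0 t] by (intro mult_left_mono) auto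
  also have "\<dots> = (t * f t) powr (1 / 2)" using t f_pos[of t] by (simp add: powr_half_sqrt real_sqrt_mult)
  also have "\<dots> \<le> P t" by simp
  finally have "1 / P t \<le> 1 / (sqrt t * sqrt (f 0))"
    using t P_pos[of t] f_pos[of 0] by (intro divide_left_mono) auto
  then show "1 / P t \<le> 1 / sqrt (f 0) / sqrt t" by (simp add: mult.commute)
qed

text \<open>Multiplying the equation by \<open>D\<close>, dropping the damping and replacing
  \<open>f + g * D powr q\<close> on \<open>{r0..r}\<close> by its upper bound \<open>H\<close> at
  \<open>r\<close> gives \<open>D\<^sup>2 \<le> (D r0)\<^sup>2 + 2 * t * H\<close>. Whichever term
  of \<open>H\<close> dominates then bounds \<open>D\<close> by a multiple of one summand of
  \<open>P\<close>.\<close>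

lemma global_if_forced_integral:
  assumes T: "g T > 0" and q1: "q \<le> 1"
    and inf: "(\<integral>\<^sup>+t\<in>{0..}. ennreal (1 / P t) \<partial>lborel) = \<infinity>"
  shows "R = \<infinity>"
proof -
  obtain r0 where r0: "0 < r0" "ereal r0 < R" "1 < \<phi> r0" "g (\<phi> r0) > 0"
    using T by (rule obtain_start)
  \<comment> \<open>Lets the initial energy be absorbed:
    \<open>(D r0)\<^sup>2 = C0 * f (\<phi> r0) \<le> C0 * (t * f t)\<close>, where
    \<open>t > 1\<close>.\<close>
  define C0 where "C0 = (D r0)\<^sup>2 / f (\<phi> r0)"
  define A where "A = C0 + 2"
  have C0: "C0 \<ge> 0" using f_pos[of "\<phi> r0"] by (simp add: C0_def)
  have A: "A > 0" using C0 by (simp add: A_def)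
  have le: "1 / P (\<phi> r) * D r \<le> (2 * A) powr (1 / 2) + (2 * A) powr (1 / (2 - q))" if r: "r0 \<le> r" "ereal r < R" for r
  proof -
    define t where "t = \<phi> r"
    define H where "H = f t + g t * D r powr q"
    have rp: "0 < r" using r r0 by simp
    have Dp: "D r > 0" using D_pos[OF rp r(2)] .
    have t: "\<phi> r0 \<le> t" "1 < t" using \<phi>_mono[OF r0(1) r] r0 by (auto simp: t_def)
    have gt: "g t > 0" using monoD[OF g_mono t(1)] r0 by simp
    have ft: "f t > 0" by (rule f_pos)
    have "(D r)\<^sup>2 / 2 - H * \<phi> r \<le> (D r0)\<^sup>2 / 2 - H * \<phi> r0"
    proof (rule DERIV_nonpos_imp_nonincreasing[OF r(1), of "\<lambda>x. (D x)\<^sup>2 / 2 - H * \<phi> x"])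
      fix x assume x: "r0 \<le> x" "x \<le> r"
      then have x': "0 < x" "ereal x < R" using r0 dom_le[OF r(2)] by auto
      have d: "((\<lambda>x. (D x)\<^sup>2 / 2 - H * \<phi> x) has_real_derivative D x * (deriv D x - H)) (at x)"
        using D_deriv[OF x'] \<phi>_deriv[OF x'] by (auto intro!: derivative_eq_intros simp: algebra_simps)
      have "\<phi> x \<le> t" using \<phi>_mono[OF x'(1) x(2) r(2)] by (simp add: t_def)
      then have "f (\<phi> x) \<le> f t" "g (\<phi> x) \<le> g t" using f_mono g_mono by (auto dest: monoD)
      moreover have "D x powr q \<le> D r powr q"
        using D_mono[OF x'(1) x(2) r(2)] D_pos[OF x'] q by (intro powr_mono2) auto
      ultimately have "f (\<phi> x) + g (\<phi> x) * D x powr q \<le> H"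
        unfolding H_def using gt by (intro add_mono order_trans[OF mult_right_mono mult_left_mono]) auto
      moreover have "(c - 1) / x * D x \<ge> 0" using c x' D_pos[OF x'] by simp
      ultimately have "D x * (deriv D x - H) \<le> 0"
        using ode'[OF x'] D_pos[OF x'] by (intro mult_nonneg_nonpos) auto
      with d show "\<exists>y. ((\<lambda>x. (D x)\<^sup>2 / 2 - H * \<phi> x) has_real_derivative y) (at x) \<and> y \<le> 0" by blast
    qed
    moreover have "0 \<le> H * \<phi> r0" using r0 gt ft by (simp add: H_def)
    ultimately have "(D r)\<^sup>2 \<le> (D r0)\<^sup>2 + 2 * (t * H)" by (simp add: t_def mult.commute)
    also have "(D r0)\<^sup>2 \<le> C0 * (t * f t)"
    proof -
      have "C0 * f (\<phi> r0) \<le> C0 * (t * f t)"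
        using monoD[OF f_mono t(1)] t ft C0 mult_mono[of 1 t "f (\<phi> r0)" "f t"] f_pos[of "\<phi> r0"]
        by (intro mult_left_mono) auto
      then show ?thesis using f_pos[of "\<phi> r0"] by (simp add: C0_def)
    qed
    also have "C0 * (t * f t) + 2 * (t * H) \<le> A * (t * f t) + A * (t * g t * D r powr q)"
      using C0 t gt ft by (simp add: A_def H_def algebra_simps)
    finally have *: "(D r)\<^sup>2 \<le> A * (t * f t) + A * (t * g t * D r powr q)" by simp
    let ?F = "(t * f t) powr (1 / 2)" and ?G = "(t * g t) powr (1 / (2 - q))"
    have P: "P t = ?F + ?G" using gt by (simp add: max_def)
    have "D r \<le> (2 * A) powr (1 / 2) * ?F \<or> D r \<le> (2 * A) powr (1 / (2 - q)) * ?G"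
    proof (cases "t * g t * D r powr q \<le> t * f t")
      case True
      then have "A * (t * g t * D r powr q) \<le> A * (t * f t)" using A by (intro mult_left_mono) auto
      then have "(D r)\<^sup>2 \<le> 2 * A * (t * f t)" using * by simp
      then have "D r \<le> sqrt (2 * A * (t * f t))" by (rule real_le_rsqrt)
      also have "\<dots> = (2 * A) powr (1 / 2) * ?F"
        using A t ft by (simp add: powr_half_sqrt real_sqrt_mult)
      finally show ?thesis by simp
    next
      case False
      then have "A * (t * f t) \<le> A * (t * g t * D r powr q)" using A by (intro mult_left_mono) auto
      then have "(D r)\<^sup>2 \<le> 2 * A * (t * g t) * D r powr q" using * by simp
      then have "D r powr 2 / D r powr q \<le> 2 * A * (t * g t)"
        using Dp by (simp add: field_simps)
      then have "D r powr (2 - q) \<le> 2 * A * (t * g t)" by (simp add: powr_diff)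
      then have "(D r powr (2 - q)) powr (1 / (2 - q)) \<le> (2 * A * (t * g t)) powr (1 / (2 - q))"
        using q1 by (intro powr_mono2) auto
      then have "D r \<le> (2 * A) powr (1 / (2 - q)) * ?G"
        using q1 Dp A t gt by (simp add: powr_powr powr_mult)
      then show ?thesis by simp
    qed
    then have "D r \<le> ((2 * A) powr (1 / 2) + (2 * A) powr (1 / (2 - q))) * P t"
      unfolding P
    proof
      assume "D r \<le> (2 * A) powr (1 / 2) * ?F"
      also have "\<dots> \<le> ((2 * A) powr (1 / 2) + (2 * A) powr (1 / (2 - q))) * (?F + ?G)"
        by (intro mult_mono) auto
      finally show "D r \<le> ((2 * A) powr (1 / 2) + (2 * A) powr (1 / (2 - q))) * (?F + ?G)" .
    next
      assume "D r \<le> (2 * A) powr (1 / (2 - q)) * ?G"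
      also have "\<dots> \<le> ((2 * A) powr (1 / 2) + (2 * A) powr (1 / (2 - q))) * (?F + ?G)"
        by (intro mult_mono) auto
      finally show "D r \<le> ((2 * A) powr (1 / 2) + (2 * A) powr (1 / (2 - q))) * (?F + ?G)" .
    qed
    moreover have "P t > 0" using P_pos t by simp
    ultimately show ?thesis by (simp add: t_def pos_divide_le_eq)
  qed
  show ?thesis
  proof (rule global_if_integral_infinite[OF inverse_P_measurable _ _ inverse_P_near_0 r0(1,2) _ le inf])
    fix t :: real assume t: "0 < t"
    show "isCont (\<lambda>t. 1 / P t) t" using q1 t by (intro inverse_P_isCont) auto
    show "0 \<le> 1 / P t" using P_pos[OF t] by simp
  qed (use r0 in auto)
qed

text \<open>Once \<open>q \<le> 1\<close> is known, \<open>D\<close> has two lower bounds, from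
  \<open>f\<close> with \<open>m = 0\<close> and from \<open>g\<close> with \<open>m = q\<close>.
  Half their sum bounds \<open>D\<close> below by a multiple of
  \<open>P (\<phi> r / 2)\<close>.\<close>

lemma forced_integral_if_global:
  assumes T: "g T > 0" and R: "R = \<infinity>"
  shows "(\<integral>\<^sup>+t\<in>{0..}. ennreal (1 / P t) \<partial>lborel) = \<infinity>"
proof -
  have q1: "q \<le> 1" by (rule exponent_le_1_if_global[OF T R])
  obtain r0 where r0: "0 < r0" "ereal r0 < R" "1 < \<phi> r0" "g (\<phi> r0) > 0"
    using T by (rule obtain_start)
  have gpos: "g (\<phi> r) > 0" if "r0 \<le> r" for r
    using monoD[OF g_mono \<phi>_mono[OF r0(1) that]] R r0 by simp
  obtain C1 where C1: "C1 > 0" "\<And>r. r0 < r \<Longrightarrow> ereal r < R \<Longrightarrow> 2 * \<phi> r0 \<le> \<phi> r \<Longrightarrow>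
      C1 * (\<phi> r / 2 * f (\<phi> r / 2)) powr (1 / (2 - 0)) \<le> D r"
    by (rule D_ge_half[of 0 r0 f]) (use r0 gpos f_cont f_mono f_pos in \<open>auto intro: less_imp_le\<close>)
  obtain C2 where C2: "C2 > 0" "\<And>r. r0 < r \<Longrightarrow> ereal r < R \<Longrightarrow> 2 * \<phi> r0 \<le> \<phi> r \<Longrightarrow>
      C2 * (\<phi> r / 2 * g (\<phi> r / 2)) powr (1 / (2 - q)) \<le> D r"
    by (rule D_ge_half[of q r0 g]) (use q q1 r0 g_cont g_mono f_pos in \<open>auto intro: less_imp_le\<close>)
  obtain r1 where r1: "r1 > 0" "2 * \<phi> r0 < \<phi> r1" using \<phi>_unbounded by blast
  define h where "h = (\<lambda>t. 1 / P (t / 2))"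
  have hm: "h \<in> borel_measurable borel"
    unfolding h_def by (rule measurable_compose[OF _ inverse_P_measurable]) measurable
  define C where "C = min C1 C2 / 2"
  have C: "C > 0" using C1 C2 by (simp add: C_def)
  have "(\<integral>\<^sup>+t\<in>{0..}. ennreal (h t) \<partial>lborel) = \<infinity>"
  proof (rule integral_infinite_if_global[OF hm _ _ r1(1) _ _ _ C R, where \<tau> = 0])
    fix t :: real assume t: "0 < t"
    show "isCont h t" unfolding h_def
      by (rule isCont_o2[OF _ inverse_P_isCont]) (use t q1 in auto)
    show "0 \<le> h t" using P_pos[of "t / 2"] t by (simp add: h_def)
  next
    fix r assume r: "r1 \<le> r"
    define t where "t = \<phi> r / 2"
    have mono: "\<phi> r1 \<le> \<phi> r" using \<phi>_mono r1 r R by simp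
    have "r0 < r" using \<phi>_mono[of r1 r0] r1 r0 r R by (cases "r1 \<le> r0") auto
    have t: "\<phi> r0 \<le> t" "0 < t" using mono r1 r0 by (auto simp: t_def)
    have gt: "g t > 0" using monoD[OF g_mono t(1)] r0 by simp
    have "C1 * (t * f t) powr (1 / 2) \<le> D r" "C2 * (t * g t) powr (1 / (2 - q)) \<le> D r"
      using C1(2)[of r] C2(2)[of r] \<open>r0 < r\<close> R mono r1 by (auto simp: t_def)
    moreover have "min C1 C2 * (t * f t) powr (1 / 2) \<le> C1 * (t * f t) powr (1 / 2)"
      "min C1 C2 * (t * g t) powr (1 / (2 - q)) \<le> C2 * (t * g t) powr (1 / (2 - q))"
      by (intro mult_right_mono; simp)+
    ultimately have "min C1 C2 * (t * f t) powr (1 / 2) + min C1 C2 * (t * g t) powr (1 / (2 - q)) \<le> 2 * D r"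
      by linarith
    then have "C * P t \<le> D r" using gt by (simp add: C_def max_def distrib_left)
    then have "C \<le> D r / P t" using P_pos[OF t(2)] by (simp only: pos_le_divide_eq)
    also have "\<dots> = h (\<phi> r) * D r" by (simp add: h_def t_def)
    finally show "C \<le> h (\<phi> r) * D r" .
  qed (use r0 r1 in auto)
  then have "2 * (\<integral>\<^sup>+t\<in>{0..}. ennreal (1 / P t) \<partial>lborel) = \<infinity>"
    unfolding h_def using nn_integral_halve_argument[OF inverse_P_measurable] by simp
  then show ?thesis by (simp add: ennreal_mult_eq_top_iff)
qed

end

section \<open>The strictly damped case\<close>

lemma nn_integral_infinite_mono:
  fixes h h' :: "real \<Rightarrow> real"
  assumes le: "\<And>t. 0 < t \<Longrightarrow> h t \<le> C * h' t" and C: "C \<ge> 0"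
    and [measurable]: "h' \<in> borel_measurable borel"
    and inf: "(\<integral>\<^sup>+t\<in>{0..}. ennreal (h t) \<partial>lborel) = \<infinity>"
  shows "(\<integral>\<^sup>+t\<in>{0..}. ennreal (h' t) \<partial>lborel) = \<infinity>"
proof -
  have "(\<integral>\<^sup>+t\<in>{0..}. ennreal (h t) \<partial>lborel) \<le> (\<integral>\<^sup>+t. ennreal C * (ennreal (h' t) * indicator {0..} t) \<partial>lborel)"
  proof (rule nn_integral_mono_AE)
    have "AE t in lborel. t \<noteq> (0::real)" by (rule AE_lborel_singleton)
    then show "AE t in lborel. ennreal (h t) * indicator {0..} t \<le> ennreal C * (ennreal (h' t) * indicator {0..} t)"
    proof eventually_elim
      case (elim t)
      show ?case
      proof (cases "t \<in> {0..}")
        case True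
        then have "ennreal (h t) \<le> ennreal (C * h' t)" using elim by (intro ennreal_leI le) auto
        then show ?thesis using True C by (simp add: ennreal_mult')
      qed simp
    qed
  qed
  also have "\<dots> = ennreal C * (\<integral>\<^sup>+t\<in>{0..}. ennreal (h' t) \<partial>lborel)"
    by (rule nn_integral_cmult) measurable
  finally have "ennreal C * (\<integral>\<^sup>+t\<in>{0..}. ennreal (h' t) \<partial>lborel) = \<infinity>"
    using inf by (simp add: top_unique)
  then show ?thesis by (auto simp: ennreal_mult_eq_top_iff)
qed

text \<open>As a supremum, the limit turns the sign conditions of the theorem into pointwise
  statements about \<open>g\<close>.\<close>

lemma Lim_at_top_mono:
  fixes g :: "real \<Rightarrow> real"
  assumes "mono g"
  shows "Lim at_top (\<lambda>t. ereal (g t)) = (SUP t. ereal (g t))"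
proof (rule tendsto_Lim)
  show "((\<lambda>t. ereal (g t)) \<longlongrightarrow> (SUP t. ereal (g t))) at_top"
  proof (rule increasing_tendsto)
    show "\<forall>\<^sub>F t in at_top. ereal (g t) \<le> (SUP t. ereal (g t))"
      by (intro always_eventually allI SUP_upper) simp
    fix x assume "x < (SUP t. ereal (g t))"
    then obtain T where T: "x < ereal (g T)" by (auto simp: less_SUP_iff)
    show "\<forall>\<^sub>F t in at_top. x < ereal (g t)"
      using eventually_ge_at_top[of T]
    proof eventually_elim
      case (elim t)
      have "ereal (g T) \<le> ereal (g t)" using monoD[OF assms elim] by simp
      with T show ?case by (rule less_le_trans)
    qed
  qed
qed simp

section \<open>Simplified criterion when g is bounded away from 0\<close>

context radial_damped
begin

lemma sqrt_\<kappa>: "sqrt (\<kappa> t) = (- g t) powr (1 / q) / f t powr (1 / q)"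
proof -
  have "sqrt (\<kappa> t) = ((- g t / f t) powr (2 / q)) powr (1 / 2)"
    using g_nonpos[of t] by (simp add: \<kappa>_eq powr_half_sqrt max_def)
  also have "\<dots> = (- g t / f t) powr (1 / q)" by (simp add: powr_powr)
  also have "\<dots> = (- g t) powr (1 / q) / f t powr (1 / q)"
    using g_nonpos[of t] f_pos[of t] by (intro powr_divide)
  finally show ?thesis .
qed

text \<open>The product is \<open>(- g) powr (2 / q) * f powr (1 - 2 / q)\<close>; both factors are
  nonincreasing, because \<open>1 - 2 / q \<le> 0\<close> for \<open>q \<le> 2\<close>. It provides
  the condition \<open>anti\<close> in the bound for \<open>1 / Y\<close>.\<close>

lemma \<kappa>_f_antimono:
  assumes "s \<le> t"
  shows "\<kappa> t * f t \<le> \<kappa> s * f s"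
proof -
  have eq: "\<kappa> u * f u = (- g u) powr (2 / q) * f u powr (1 - 2 / q)" for u
  proof -
    have "\<kappa> u = (- g u) powr (2 / q) / f u powr (2 / q)"
      using g_nonpos[of u] f_pos[of u] by (simp add: \<kappa>_eq powr_divide max_def)
    moreover have "f u powr (1 - 2 / q) = f u / f u powr (2 / q)"
      using f_pos[of u] by (simp add: powr_diff)
    ultimately show ?thesis by simp
  qed
  have "(- g t) powr (2 / q) \<le> (- g s) powr (2 / q)"
    using g_nonpos[of t] monoD[OF g_mono assms] q by (intro powr_mono2) auto
  moreover have "f t powr (1 - 2 / q) \<le> f s powr (1 - 2 / q)"
    using f_pos[of s] monoD[OF f_mono assms] q by (intro powr_mono2') (auto simp: field_simps)
  ultimately show ?thesis unfolding eq by (intro mult_mono) auto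
qed

text \<open>One direction takes square roots in the bound for \<open>1 / Y\<close>, with
  \<open>- g \<le> - g 0\<close> on the half-line. The other combines \<open>Y \<le> t * f\<close>
  with \<open>\<kappa> * Y \<le> 1\<close>, where \<open>- g \<ge> \<gamma>\<close> makes
  \<open>sqrt \<kappa>\<close> at least a multiple of \<open>1 / f powr (1 / q)\<close>.\<close>

lemma damped_integral_iff:
  assumes \<gamma>: "\<gamma> > 0" "\<And>t. g t \<le> - \<gamma>"
  shows "(\<integral>\<^sup>+t\<in>{0..}. ennreal (1 / sqrt (Y 0 t)) \<partial>lborel) = \<infinity> \<longleftrightarrow>
    (\<integral>\<^sup>+t\<in>{0..}. ennreal (1 / (t * f t) powr (1 / 2) + 1 / f t powr (1 / q)) \<partial>lborel) = \<infinity>"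
proof -
  define h where "h = (\<lambda>t. 1 / (t * f t) powr (1 / 2) + 1 / f t powr (1 / q))"
  have [measurable]: "f \<in> borel_measurable borel"
    using f_cont by (auto intro: borel_measurable_continuous_onI)
  have hm: "h \<in> borel_measurable borel" unfolding h_def by measurable
  have up: "1 / sqrt (Y 0 t) \<le> sqrt (2 * exp 1) * (1 + (- g 0) powr (1 / q)) * h (t / 2)" if t: "0 < t" for t
  proof -
    let ?A = "1 / (t / 2 * f (t / 2)) powr (1 / 2)" and ?B = "1 / f (t / 2) powr (1 / q)"
    define p where "p = (- g 0) powr (1 / q)"
    have p: "p \<ge> 0" by (simp add: p_def)
    have ft: "f (t / 2) > 0" by (rule f_pos)
    have "1 / sqrt (Y 0 t) = sqrt (1 / Y 0 t)" by (simp add: real_sqrt_divide)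
    also have "\<dots> \<le> sqrt (2 * exp 1 * (1 / (t * f (t / 2)) + \<kappa> (t / 2)))"
      using t \<kappa>_f_antimono by (intro real_sqrt_le_mono inverse_Y_le)
    also have "\<dots> = sqrt (2 * exp 1) * sqrt (1 / (t * f (t / 2)) + \<kappa> (t / 2))"
      by (rule real_sqrt_mult)
    also have "\<dots> \<le> sqrt (2 * exp 1) * (sqrt (1 / (t * f (t / 2))) + sqrt (\<kappa> (t / 2)))"
      using t ft \<kappa>_nonneg by (intro mult_left_mono sqrt_add_le_add_sqrt) auto
    also have "\<dots> \<le> sqrt (2 * exp 1) * (?A + p * ?B)"
    proof (intro mult_left_mono add_mono)
      have "?A = sqrt (1 / (t / 2 * f (t / 2)))"
        using t ft by (simp add: powr_half_sqrt real_sqrt_divide)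
      moreover have "sqrt (1 / (t * f (t / 2))) \<le> sqrt (1 / (t / 2 * f (t / 2)))"
        using t ft by (intro real_sqrt_le_mono divide_left_mono) auto
      ultimately show "sqrt (1 / (t * f (t / 2))) \<le> ?A" by simp
      have "(- g (t / 2)) powr (1 / q) \<le> p"
        unfolding p_def using g_nonpos[of "t / 2"] monoD[OF g_mono, of 0 "t / 2"] q t by (intro powr_mono2) auto
      then have "(- g (t / 2)) powr (1 / q) / f (t / 2) powr (1 / q) \<le> p / f (t / 2) powr (1 / q)"
        by (rule divide_right_mono) simp
      then show "sqrt (\<kappa> (t / 2)) \<le> p * ?B" by (simp add: sqrt_\<kappa>)
    qed simp
    also have "\<dots> \<le> sqrt (2 * exp 1) * ((1 + p) * (?A + ?B))"
    proof (rule mult_left_mono)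
      have "0 \<le> p * ?A" "0 \<le> ?B" using p by auto
      then show "?A + p * ?B \<le> (1 + p) * (?A + ?B)" unfolding distrib_left distrib_right by linarith
    qed simp
    finally show ?thesis by (simp only: h_def p_def mult.assoc)
  qed
  have low: "h t \<le> (1 + 1 / \<gamma> powr (1 / q)) * (1 / sqrt (Y 0 t))" if t: "0 < t" for t
  proof -
    have ft: "f t > 0" by (rule f_pos)
    have Yp: "0 < Y 0 t" using t by (rule Y_pos)
    have "sqrt (Y 0 t) \<le> (t * f t) powr (1 / 2)"
      using Y_le[of 0 t] t ft by (simp add: powr_half_sqrt)
    then have 1: "1 / (t * f t) powr (1 / 2) \<le> 1 / sqrt (Y 0 t)"
      using Yp t ft by (intro divide_left_mono) auto
    have "\<kappa> t * Y 0 t \<le> 1"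
      using \<kappa>_Y_le[of 0 t] t mult_nonneg_nonneg[OF \<kappa>_nonneg[of t] less_imp_le[OF Yp]] by linarith
    then have "sqrt (\<kappa> t) * sqrt (Y 0 t) \<le> 1"
      using real_sqrt_le_mono[of "\<kappa> t * Y 0 t" 1] by (simp add: real_sqrt_mult)
    moreover have "\<gamma> powr (1 / q) / f t powr (1 / q) \<le> sqrt (\<kappa> t)"
      unfolding sqrt_\<kappa> using \<gamma>(1) \<gamma>(2)[of t] q by (intro divide_right_mono powr_mono2) auto
    then have "\<gamma> powr (1 / q) / f t powr (1 / q) * sqrt (Y 0 t) \<le> sqrt (\<kappa> t) * sqrt (Y 0 t)"
      using Yp by (intro mult_right_mono) auto
    ultimately have "\<gamma> powr (1 / q) / f t powr (1 / q) * sqrt (Y 0 t) \<le> 1" by linarith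
    then have "1 / f t powr (1 / q) \<le> 1 / \<gamma> powr (1 / q) * (1 / sqrt (Y 0 t))"
      using \<gamma> ft Yp by (simp add: field_simps)
    with 1 show ?thesis unfolding h_def distrib_right by linarith
  qed
  show ?thesis
  proof
    assume inf: "(\<integral>\<^sup>+t\<in>{0..}. ennreal (1 / sqrt (Y 0 t)) \<partial>lborel) = \<infinity>"
    have "(\<integral>\<^sup>+t\<in>{0..}. ennreal (h (t / 2)) \<partial>lborel) = \<infinity>"
      by (rule nn_integral_infinite_mono[OF up _ _ inf]) (use hm in \<open>auto intro: measurable_compose[OF _ hm]\<close>)
    then have "2 * (\<integral>\<^sup>+t\<in>{0..}. ennreal (h t) \<partial>lborel) = \<infinity>"
      using nn_integral_halve_argument[OF hm] by simp
    then show "(\<integral>\<^sup>+t\<in>{0..}. ennreal (1 / (t * f t) powr (1 / 2) + 1 / f t powr (1 / q)) \<partial>lborel) = \<infinity>"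
      by (simp add: h_def ennreal_mult_eq_top_iff)
  next
    assume "(\<integral>\<^sup>+t\<in>{0..}. ennreal (1 / (t * f t) powr (1 / 2) + 1 / f t powr (1 / q)) \<partial>lborel) = \<infinity>"
    then have inf: "(\<integral>\<^sup>+t\<in>{0..}. ennreal (h t) \<partial>lborel) = \<infinity>" by (simp only: h_def)
    show "(\<integral>\<^sup>+t\<in>{0..}. ennreal (1 / sqrt (Y 0 t)) \<partial>lborel) = \<infinity>"
      by (rule nn_integral_infinite_mono[OF low _ inverse_sqrt_Y_measurable inf]) simp_all
  qed
qed

end

context maximal_radial_solution
begin

text \<open>The weight is continuous, so both primitives exist; it is nonincreasing because the
  negative part of \<open>g\<close> is nonincreasing and \<open>f\<close> is nondecreasing.\<close>

lemma obtain_damped: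
  assumes g0: "\<And>t. g t \<le> 0"
  obtains K Z where "radial_damped f g q c a \<phi> R (\<lambda>t. (max (- g t) 0 / f t) powr (2 / q)) K Z"
proof -
  define \<kappa> where "\<kappa> = (\<lambda>t. (max (- g t) 0 / f t) powr (2 / q))"
  have f_ne: "f t \<noteq> 0" for t using f_pos[of t] by simp
  have "continuous_on UNIV \<kappa>"
    unfolding \<kappa>_def using q f_pos
    by (intro continuous_on_powr' continuous_intros f_cont g_cont) (auto simp: f_ne less_imp_le)
  then have c1: "continuous_on UNIV (\<lambda>t. \<kappa> t * f t)" by (intro continuous_intros f_cont)
  obtain K where K: "\<And>t. (K has_real_derivative \<kappa> t * f t) (at t)"
    using continuous_antiderivative[of "-\<infinity>" "\<lambda>t. \<kappa> t * f t"] c1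
    by (auto simp: continuous_on_eq_continuous_at)
  have "continuous_on UNIV K" using K by (auto intro!: continuous_at_imp_continuous_on DERIV_isCont)
  then have c2: "continuous_on UNIV (\<lambda>t. exp (2 * K t) * f t)" by (intro continuous_intros f_cont)
  obtain Z where Z: "\<And>t. (Z has_real_derivative exp (2 * K t) * f t) (at t)"
    using continuous_antiderivative[of "-\<infinity>" "\<lambda>t. exp (2 * K t) * f t"] c2
    by (auto simp: continuous_on_eq_continuous_at)
  have "radial_damped f g q c a \<phi> R \<kappa> K Z"
  proof unfold_locales
    show "\<kappa> t \<le> \<kappa> s" if "s \<le> t" for s t
      unfolding \<kappa>_def using monoD[OF f_mono that] monoD[OF g_mono that] f_pos[of s] q f_pos[of t]
      by (intro powr_mono2 frac_le) auto
  qed (use f_cont f_mono f_pos K Z g0 in \<open>auto simp: \<kappa>_def\<close>)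
  then show ?thesis using that unfolding \<kappa>_def by blast
qed

end

theorem theorem2p5:
  fixes f g :: "real \<Rightarrow> real" and q c a :: real
    and \<phi> :: "real \<Rightarrow> real" and R :: ereal
  assumes q: "0 < q" "q \<le> 2"
    and c: "c \<ge> 1"
    and f_cont: "continuous_on UNIV f" and f_mono: "mono f" and f_pos: "\<forall>t. f t > 0"
    and g_cont: "continuous_on UNIV g" and g_mono: "mono g"
    and sol: "maximal_cauchy_solution f g c q a \<phi> R"
  shows
    "(Lim at_top (\<lambda>t. ereal (g t)) > 0 \<longrightarrow>
       (R = \<infinity> \<longleftrightarrow>
         q \<le> 1 \<and>
         (\<integral>\<^sup>+ t\<in>{0..}. ennreal (1 / ((t * f t) powr (1/2)
                                   + (t * max (g t) 0) powr (1 / (2 - q)))) \<partial>lborel) = \<infinity>))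
     \<and>
     (Lim at_top (\<lambda>t. ereal (g t)) \<le> 0 \<longrightarrow>
       (R = \<infinity> \<longleftrightarrow>
         (\<integral>\<^sup>+ t\<in>{0..}. ennreal (1 / sqrt (integral {0..t} (\<lambda>s.
              exp (- 2 * integral {s..t} (\<lambda>\<tau>. (max (- g \<tau>) 0 / f \<tau>) powr (2 / q) * f \<tau>))
              * f s))) \<partial>lborel) = \<infinity>))
     \<and>
     (Lim at_top (\<lambda>t. ereal (g t)) < 0 \<longrightarrow>
       ((\<integral>\<^sup>+ t\<in>{0..}. ennreal (1 / sqrt (integral {0..t} (\<lambda>s.
              exp (- 2 * integral {s..t} (\<lambda>\<tau>. (max (- g \<tau>) 0 / f \<tau>) powr (2 / q) * f \<tau>))
              * f s))) \<partial>lborel) = \<infinity>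
        \<longleftrightarrow>
        (\<integral>\<^sup>+ t\<in>{0..}. ennreal (1 / (t * f t) powr (1/2) + 1 / f t powr (1 / q)) \<partial>lborel) = \<infinity>))"
    (is "(?L > 0 \<longrightarrow> ?i) \<and> (?L \<le> 0 \<longrightarrow> (_ \<longleftrightarrow> ?J = \<infinity>)) \<and> (?L < 0 \<longrightarrow> (_ \<longleftrightarrow> ?iii))")
proof -
  interpret maximal_radial_solution f g q c a \<phi> R
    by unfold_locales (use assms in \<open>auto simp: maximal_cauchy_solution_def\<close>)
  have L: "?L = (SUP t. ereal (g t))" by (rule Lim_at_top_mono[OF g_mono])
  \<comment> \<open>Stated for arbitrary \<open>K\<close> and \<open>Z\<close>, which become
    available only later, under a sign condition on \<open>g\<close>.\<close>
  have J: "?J = (\<integral>\<^sup>+ t\<in>{0..}. ennreal (1 / sqrt (damped_primitive.Y K Z 0 t)) \<partial>lborel)"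
    if "radial_damped f g q c a \<phi> R (\<lambda>t. (max (- g t) 0 / f t) powr (2 / q)) K Z" for K Z
  proof -
    interpret radial_damped f g q c a \<phi> R "\<lambda>t. (max (- g t) 0 / f t) powr (2 / q)" K Z by fact
    show ?thesis
    proof (rule nn_integral_cong)
      fix t :: real
      show "ennreal (1 / sqrt (integral {0..t} (\<lambda>s.
            exp (- 2 * integral {s..t} (\<lambda>\<tau>. (max (- g \<tau>) 0 / f \<tau>) powr (2 / q) * f \<tau>)) * f s))) *
          indicator {0..} t = ennreal (1 / sqrt (Y 0 t)) * indicator {0..} t"
        by (cases "0 \<le> t") (simp only: Y_eq_integral, simp)
    qed
  qed
  show ?thesis
  proof (intro conjI impI)
    assume "?L > 0"
    then obtain T where "g T > 0" by (auto simp: L less_SUP_iff)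
    then show ?i
      using exponent_le_1_if_global forced_integral_if_global global_if_forced_integral by blast
  next
    assume "?L \<le> 0"
    then have "g t \<le> 0" for t by (auto simp: L SUP_le_iff)
    then obtain K Z where KZ: "radial_damped f g q c a \<phi> R (\<lambda>t. (max (- g t) 0 / f t) powr (2 / q)) K Z"
      using obtain_damped by blast
    show "R = \<infinity> \<longleftrightarrow> ?J = \<infinity>"
      unfolding J[OF KZ] by (rule radial_damped.global_iff_damped[OF KZ])
  next
    assume "?L < 0"
    \<comment> \<open>A number strictly between the limit and 0 supplies the uniform gap
      \<open>\<gamma> = - x\<close>.\<close>
    then obtain x where x: "(SUP t. ereal (g t)) < ereal x" "ereal x < 0"
      unfolding L using ereal_dense2 by blast
    have gx: "g t \<le> - (- x)" for t
    proof -
      have "ereal (g t) \<le> (SUP t. ereal (g t))" by (rule SUP_upper) simp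
      then have "ereal (g t) < ereal x" using x(1) by (rule le_less_trans)
      then show ?thesis by simp
    qed
    have "g t \<le> 0" for t using gx[of t] x(2) by simp
    then obtain K Z where KZ: "radial_damped f g q c a \<phi> R (\<lambda>t. (max (- g t) 0 / f t) powr (2 / q)) K Z"
      using obtain_damped by blast
    show "?J = \<infinity> \<longleftrightarrow> ?iii"
      unfolding J[OF KZ] by (rule radial_damped.damped_integral_iff[OF KZ, of "- x"]) (use x gx in auto)
  qed
qed

end
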